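(* Let $\Gamma$ be a countable group and let $\varphi_o:\Gamma\to\mathbb{R}$ be a quasimorphism with $\varphi_o(e)=0$ which is not at bounded distance from a homomorphism $\Gamma\to\mathbb{R}$. Let $p$ be a symmetric probability measure on $\Gamma\times\mathbb{R}$, absolutely continuous with respect to Haar measure, whose support generates $\Gamma\times\mathbb{R}$ as a semigroup, and such that $\varphi_o$ is $p$-integrable. Let $P\subset\mathbb{R}$ be a closed subset such that the $\mathbb{R}$-action on $\Omega_P$ is free and uniquely ergodic with invariant probability measure $\theta$. Let $c:\Gamma\times\Delta_{\varphi_o}\to\mathbb{R}$, $c(\gamma,\varphi)=\varphi(\gamma)$. Then the map $$\mathrm{Prob}_p(\Delta_{\varphi_o})\to\mathrm{Prob}_p(\Delta_{\varphi_o}\times_c\Omega_P),\quad\nu\mapsto\nu\otimes\theta$$ is bijective. In particular, $\mathrm{Prob}_p(\Omega_{P(\varphi_o)})\cong\mathrm{Prob}_p(\Delta_{\varphi_o})$.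
   Context: $\varphi:\Gamma\to\mathbb{R}$ is a quasimorphism if $\sup_{g,h}|\varphi(gh)-\varphi(g)-\varphi(h)|<\infty$. Functions are at bounded distance if their difference is bounded. $\Gamma$ is discrete. $\mathscr{F}_o(\Gamma):=\{\varphi\in\mathbb{R}^\Gamma\mid\varphi(e)=0\}$ carries the product topology and the $\Gamma$-action $(\gamma.\varphi)(\gamma')=\varphi(\gamma'\gamma)-\varphi(\gamma)$; $\Delta_{\varphi_o}$ is the closure of the $\Gamma$-orbit of $\varphi_o$ in $\mathscr{F}_o(\Gamma)$. The twist of a closed $P\subset\mathbb{R}$ is $P(\varphi_o):=\{(\gamma,t)\in\Gamma\times\mathbb{R}\mid\varphi_o(\gamma)+t\in P\}$. For a locally compact second countable group $G$, $\mathscr{C}(G)$ is the space of closed subsets of $G$ with the Chabauty-Fell topology and action $g.Q:=Qg^{-1}$; the hull $\Omega_Q$ of a closed $Q\subset G$ is the closure of its $G$-orbit in $\mathscr{C}(G)$. Given a $\Gamma$-space $\Delta$, an $\mathbb{R}$-space $\Omega$ and a continuous cocycle $c:\Gamma\times\Delta\to\mathbb{R}$, $\Delta\times_c\Omega$ is $\Delta\times\Omega$ with the $(\Gamma\times\mathbb{R})$-action $(\gamma,t).(y,\omega):=(\gamma.y,(c(\gamma,y)+t).\omega)$. Let $p_\Gamma$ be the push-forward of $p$ to $\Gamma$. $\varphi_o$ is $p$-integrable if $\sum_\gamma p_\Gamma(\gamma)|\varphi_o(\gamma)|<\infty$. $\mathrm{Prob}_p(X)$ denotes the set of $p$-stationary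 Borel probability measures on $X$ ($p*\nu=\nu$) for a $(\Gamma\times\mathbb{R})$-space $X$; for the $\Gamma$-space $\Delta_{\varphi_o}$ it denotes the set of $p_\Gamma$-stationary ones. Uniquely ergodic means having exactly one invariant Borel probability measure. The final identification is via the $(\Gamma\times\mathbb{R})$-equivariant homeomorphism $\Delta_{\varphi_o}\times_c\Omega_P\to\Omega_{P(\varphi_o)}$, $(\varphi,Q)\mapsto\{(\gamma,t)\mid\varphi(\gamma)+t\in Q\}$. *)

theory Defs
  imports "HOL-Probability.Probability"
begin

text \<open>
  Groups are written additively: class \<^class>\<open>group_add\<close> does not assume commutativity, and
  \<^term>\<open>x - g\<close> is \<^term>\<open>x + (- g)\<close>. The group \<open>\<Gamma> \<times> \<real>\<close> is the product type with its
  componentwise group structure and product topology, \<open>\<Gamma>\<close> being discrete.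
\<close>

subsection \<open>Quasimorphisms\<close>

definition quasimorphism :: "('g::group_add \<Rightarrow> real) \<Rightarrow> bool" where
  "quasimorphism \<phi> \<longleftrightarrow> bdd_above (range (\<lambda>(g, h). \<bar>\<phi> (g + h) - \<phi> g - \<phi> h\<bar>))"

definition real_hom :: "('g::group_add \<Rightarrow> real) \<Rightarrow> bool" where
  "real_hom \<psi> \<longleftrightarrow> (\<forall>g h. \<psi> (g + h) = \<psi> g + \<psi> h)"

definition at_bounded_distance :: "('g \<Rightarrow> real) \<Rightarrow> ('g \<Rightarrow> real) \<Rightarrow> bool" where
  "at_bounded_distance \<phi> \<psi> \<longleftrightarrow> bounded (range (\<lambda>g. \<phi> g - \<psi> g))"

subsection \<open>The space of pointed functions and orbit closures in it\<close>

text \<open>The topology on the function type is the product topology (pointwise convergence).\<close>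

definition pointed_functions :: "('g::group_add \<Rightarrow> real) topology" where
  "pointed_functions = subtopology euclidean {\<phi>. \<phi> 0 = 0}"

definition fun_act :: "'g::group_add \<Rightarrow> ('g \<Rightarrow> real) \<Rightarrow> ('g \<Rightarrow> real)" where
  "fun_act g \<phi> = (\<lambda>h. \<phi> (h + g) - \<phi> g)"

definition orbit_closure_space :: "('g::group_add \<Rightarrow> real) \<Rightarrow> ('g \<Rightarrow> real) topology" where
  "orbit_closure_space \<phi> =
     subtopology pointed_functions (pointed_functions closure_of range (\<lambda>g. fun_act g \<phi>))"

subsection \<open>Chabauty-Fell space, hulls and twists\<close>

definition chabauty_fell :: "'a::topological_space set topology" where
  "chabauty_fell = topology_generated_by
     ({{F. closed F \<and> F \<inter> K = {}} | K. compact K} \<union>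
      {{F. closed F \<and> F \<inter> U \<noteq> {}} | U. open U})"

definition set_act :: "'a::group_add \<Rightarrow> 'a set \<Rightarrow> 'a set" where
  "set_act g Q = (\<lambda>x. x - g) ` Q"

definition hull_space :: "'a::{group_add, topological_space} set \<Rightarrow> 'a set topology" where
  "hull_space Q = subtopology chabauty_fell (chabauty_fell closure_of range (\<lambda>g. set_act g Q))"

definition twist :: "real set \<Rightarrow> ('g \<Rightarrow> real) \<Rightarrow> ('g \<times> real) set" where
  "twist P \<phi> = {(g, t). \<phi> g + t \<in> P}"

subsection \<open>Actions\<close>

definition free_action :: "('a::zero \<Rightarrow> 'x \<Rightarrow> 'x) \<Rightarrow> 'x topology \<Rightarrow> bool" where
  "free_action act X \<longleftrightarrow> (\<forall>x\<in>topspace X. \<forall>g. act g x = x \<longrightarrow> g = 0)"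

text \<open>
  The space \<open>\<Delta> \<times>\<^sub>c \<Omega>\<close> is \<^const>\<open>prod_topology\<close> of the two spaces, with the following action.
\<close>

definition skew_act ::
  "('g \<Rightarrow> 'y \<Rightarrow> 'y) \<Rightarrow> (real \<Rightarrow> 'w \<Rightarrow> 'w) \<Rightarrow> ('g \<Rightarrow> 'y \<Rightarrow> real) \<Rightarrow> 'g \<times> real \<Rightarrow> 'y \<times> 'w \<Rightarrow> 'y \<times> 'w"
where
  "skew_act a b c = (\<lambda>(g, t) (y, w). (a g y, b (c g y + t) w))"

subsection \<open>Measures\<close>

definition borel_of :: "'x topology \<Rightarrow> 'x measure" where
  "borel_of X = sigma (topspace X) {U. openin X U}"

definition borel_probs :: "'x topology \<Rightarrow> 'x measure set" where
  "borel_probs X = {\<nu>. prob_space \<nu> \<and> sets \<nu> = sets (borel_of X)}"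

definition invariant_probs :: "('a \<Rightarrow> 'x \<Rightarrow> 'x) \<Rightarrow> 'x topology \<Rightarrow> 'x measure set" where
  "invariant_probs act X = {\<nu> \<in> borel_probs X. \<forall>g. distr \<nu> (borel_of X) (act g) = \<nu>}"

definition uniquely_ergodic :: "('a \<Rightarrow> 'x \<Rightarrow> 'x) \<Rightarrow> 'x topology \<Rightarrow> bool" where
  "uniquely_ergodic act X \<longleftrightarrow> (\<exists>!\<nu>. \<nu> \<in> invariant_probs act X)"

text \<open>The convolution \<open>p * \<nu>\<close> is the push-forward of \<open>p \<otimes> \<nu>\<close> under the action map.\<close>

definition stationary_probs ::
  "'a measure \<Rightarrow> ('a \<Rightarrow> 'x \<Rightarrow> 'x) \<Rightarrow> 'x topology \<Rightarrow> 'x measure set" where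
  "stationary_probs p act X =
     {\<nu> \<in> borel_probs X. distr (p \<Otimes>\<^sub>M \<nu>) (borel_of X) (\<lambda>(g, x). act g x) = \<nu>}"

text \<open>
  On a locally compact second countable group, regularity of a Borel measure follows from
  finiteness on compact sets, so it is not required separately.
\<close>

definition haar_measure :: "'a::{group_add, topological_space} measure \<Rightarrow> bool" where
  "haar_measure \<mu> \<longleftrightarrow> sets \<mu> = sets borel \<and> emeasure \<mu> UNIV \<noteq> 0 \<and>
     (\<forall>K. compact K \<longrightarrow> emeasure \<mu> K < \<infinity>) \<and> (\<forall>g. distr \<mu> borel (\<lambda>x. g + x) = \<mu>)"

definition symmetric_measure :: "'a::{group_add, topological_space} measure \<Rightarrow> bool" where
  "symmetric_measure p \<longleftrightarrow> distr p borel uminus = p"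

definition measure_support :: "'a::topological_space measure \<Rightarrow> 'a set" where
  "measure_support p = {x. \<forall>U. open U \<longrightarrow> x \<in> U \<longrightarrow> emeasure p U > 0}"

definition semigroup_generated :: "'a::plus set \<Rightarrow> 'a set" where
  "semigroup_generated A = (\<lambda>S. \<forall>x\<in>S. \<forall>y\<in>S. x + y \<in> S) hull A"

definition push_fst :: "('g::topological_space \<times> real) measure \<Rightarrow> 'g measure" where
  "push_fst p = distr p borel fst"

definition p_integrable :: "('g::topological_space \<times> real) measure \<Rightarrow> ('g \<Rightarrow> real) \<Rightarrow> bool" where
  "p_integrable p \<phi> \<longleftrightarrow> (\<lambda>g. measure (push_fst p) {g} * \<bar>\<phi> g\<bar>) summable_on UNIV"

end

theory Submission
  imports Defs
begin

text \<open>
  Write \<open>\<Delta>\<close> for the orbit closure of the quasimorphism and \<open>\<Omega>\<close> for the hull of \<open>P\<close>. The line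
  \<open>0 \<times> \<real>\<close> is central in \<open>\<Gamma> \<times> \<real>\<close> and acts on \<open>\<Delta> \<times>\<^sub>c \<Omega>\<close> through the second factor only. The point of
  the proof is that every stationary measure \<open>\<eta>\<close> on \<open>\<Delta> \<times>\<^sub>c \<Omega>\<close> is invariant under this line.

  To see this, take a bounded function \<open>f\<close> and put \<open>h g = \<integral> f (g.x) d\<eta>(x)\<close>. This is a bounded
  harmonic function, and if \<open>f\<close> is Lipschitz along the orbits of the line, then, by centrality, \<open>h\<close>
  is Lipschitz in the real coordinate, uniformly on the group. For central \<open>z\<close> the increment
  \<open>u g = h (g + z) - h g\<close> is again harmonic. Because the support of \<open>p\<close> generates the group as a
  semigroup, near-maximality of \<open>u\<close> at \<open>g\<close> passes on to \<open>g + x\<close> for every \<open>x\<close>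
  (lemma \<open>harmonic_near_maximum\<close>), in particular to \<open>g + k z\<close>. A positive supremum of \<open>u\<close> would
  therefore make \<open>h\<close> grow by arbitrarily much along suitable progressions \<open>g, g + z, \<dots>, g + N z\<close>,
  so \<open>h (g + z) = h g\<close>
  (lemmas \<open>harmonic_central_invariant\<close> and \<open>stationary_integral_central\<close>).

  This is applied to \<open>f (\<psi>, F) = 1\<^sub>B \<psi> * s F\<close> with \<open>B\<close> an arbitrary Borel subset of \<open>\<Delta>\<close> and \<open>s\<close> a
  Lipschitz approximation of the indicator of the closed sets that miss a given compact set. Such
  sets form a generating \<open>\<pi>\<close>-system of the Borel sets of \<open>\<Omega>\<close>, so each measure \<open>A \<mapsto> \<eta> (B \<times> A)\<close> is
  invariant under the line, hence equal to \<open>\<eta> (B \<times> \<Omega>) \<theta>\<close> by unique ergodicity. This says that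
  \<open>\<eta> = \<nu> \<otimes> \<theta>\<close> with \<open>\<nu>\<close> the marginal of \<open>\<eta>\<close> (lemma \<open>stationary_skew_product\<close>). The converse is Fubini's
  theorem together with the invariance of \<open>\<theta>\<close> (lemma \<open>stationary_pair_measure\<close>).

  For the hull of the twist, the space \<open>\<Delta> \<times> \<Omega>\<close> is compact, by Tychonoff's theorem (a quasimorphism
  has a relatively compact orbit) and by Fell's theorem, so the equivariant continuous bijection onto
  the Hausdorff hull of the twist is a homeomorphism (lemma \<open>homeomorphic_map_twist_map\<close>), along
  which stationary measures are transported.
\<close>

section \<open>Borel sets of abstract topologies\<close>

lemma space_borel_of [simp]: "space (borel_of X) = topspace X"
  unfolding borel_of_def by (rule space_measure_of) (auto dest: openin_subset)

lemma sets_borel_of: "sets (borel_of X) = sigma_sets (topspace X) {U. openin X U}"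
  unfolding borel_of_def by (rule sets_measure_of) (auto dest: openin_subset)

lemma openin_borel_of: "openin X U \<Longrightarrow> U \<in> sets (borel_of X)"
  by (auto simp: sets_borel_of)

lemma borel_of_subset_sets:
  assumes "space M = topspace X" "\<And>U. openin X U \<Longrightarrow> U \<in> sets M"
  shows "sets (borel_of X) \<subseteq> sets M"
  unfolding sets_borel_of using assms sets.sigma_sets_subset[of "{U. openin X U}" M] by auto

lemma borel_of_euclidean [simp]: "borel_of euclidean = borel"
  unfolding borel_of_def borel_def by simp

lemma measurable_continuous_map:
  assumes "continuous_map X Y f"
  shows "f \<in> borel_of X \<rightarrow>\<^sub>M borel_of Y"
proof (rule measurable_sigma_sets[OF sets_borel_of])
  show "{U. openin Y U} \<subseteq> Pow (topspace Y)"
    by (auto dest: openin_subset)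
  show "f \<in> space (borel_of X) \<rightarrow> topspace Y"
    using assms by (auto simp: continuous_map_def)
  fix U assume "U \<in> {U. openin Y U}"
  then have "openin X {x \<in> topspace X. f x \<in> U}"
    using assms by (auto simp: continuous_map_def)
  moreover have "f -` U \<inter> space (borel_of X) = {x \<in> topspace X. f x \<in> U}" by auto
  ultimately show "f -` U \<inter> space (borel_of X) \<in> sets (borel_of X)"
    by (simp add: openin_borel_of)
qed

lemma second_countable_euclidean: "second_countable (euclidean :: 'a::second_countable_topology topology)"
proof -
  obtain B :: "'a set set" where "countable B" "topological_basis B"
    using ex_countable_basis by blast
  then show ?thesis
    unfolding second_countable_def
    by (intro exI[of _ B]) (meson open_openin topological_basisE topological_basis_open)
qed

text \<open>
  Second countability is needed for the inclusion from left to right: an open subset of the product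
  is then a countable union of open rectangles.
\<close>

lemma sets_borel_of_prod:
  assumes "second_countable X" "second_countable Y"
  shows "sets (borel_of (prod_topology X Y)) = sets (borel_of X \<Otimes>\<^sub>M borel_of Y)"
proof
  obtain A B where A: "countable A" "\<And>V. V \<in> A \<Longrightarrow> openin X V"
      "\<And>U x. openin X U \<Longrightarrow> x \<in> U \<Longrightarrow> \<exists>V\<in>A. x \<in> V \<and> V \<subseteq> U"
    and B: "countable B" "\<And>V. V \<in> B \<Longrightarrow> openin Y V"
      "\<And>U x. openin Y U \<Longrightarrow> x \<in> U \<Longrightarrow> \<exists>V\<in>B. x \<in> V \<and> V \<subseteq> U"
    using assms unfolding second_countable_def by metis
  show "sets (borel_of (prod_topology X Y)) \<subseteq> sets (borel_of X \<Otimes>\<^sub>M borel_of Y)"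
  proof (rule borel_of_subset_sets)
    show "space (borel_of X \<Otimes>\<^sub>M borel_of Y) = topspace (prod_topology X Y)"
      by (simp add: space_pair_measure)
    fix W assume W: "openin (prod_topology X Y) W"
    let ?C = "{(U, V) \<in> A \<times> B. U \<times> V \<subseteq> W}"
    have "W = (\<Union>(U, V) \<in> ?C. U \<times> V)"
    proof (intro equalityI subsetI)
      fix z assume z: "z \<in> W"
      obtain x y where xy: "z = (x, y)" by fastforce
      obtain U V where UV: "openin X U" "openin Y V" "x \<in> U" "y \<in> V" "U \<times> V \<subseteq> W"
        using W[unfolded openin_prod_topology_alt, rule_format, OF z[unfolded xy]] by auto
      obtain U' V' where "U' \<in> A" "x \<in> U'" "U' \<subseteq> U" "V' \<in> B" "y \<in> V'" "V' \<subseteq> V"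
        using A(3)[OF UV(1,3)] B(3)[OF UV(2,4)] by blast
      then have "(U', V') \<in> ?C" "z \<in> U' \<times> V'"
        using UV(5) xy by auto
      then show "z \<in> (\<Union>(U, V) \<in> ?C. U \<times> V)" by blast
    qed auto
    moreover have "countable ?C"
      by (rule countable_subset[of _ "A \<times> B"]) (use A B in auto)
    moreover have "U \<times> V \<in> sets (borel_of X \<Otimes>\<^sub>M borel_of Y)" if "(U, V) \<in> ?C" for U V
      using that A B by (auto intro!: pair_measureI openin_borel_of)
    ultimately have "(\<Union>(U, V) \<in> ?C. U \<times> V) \<in> sets (borel_of X \<Otimes>\<^sub>M borel_of Y)"
      by (intro sets.countable_UN'') auto
    with \<open>W = _\<close> show "W \<in> sets (borel_of X \<Otimes>\<^sub>M borel_of Y)" by simp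
  qed
  have id: "(\<lambda>x. x) \<in> borel_of (prod_topology X Y) \<rightarrow>\<^sub>M borel_of X \<Otimes>\<^sub>M borel_of Y"
    by (rule measurable_pair)
      (auto simp: comp_def intro: measurable_continuous_map continuous_map_fst continuous_map_snd)
  show "sets (borel_of X \<Otimes>\<^sub>M borel_of Y) \<subseteq> sets (borel_of (prod_topology X Y))"
  proof
    fix A assume A: "A \<in> sets (borel_of X \<Otimes>\<^sub>M borel_of Y)"
    have "A \<subseteq> topspace (prod_topology X Y)"
      using sets.sets_into_space[OF A] by (simp add: space_pair_measure)
    then show "A \<in> sets (borel_of (prod_topology X Y))"
      using measurable_sets[OF id A] by (simp add: Int_absorb2)
  qed
qed

lemma generate_topology_on_base:
  assumes "generate_topology_on S U" "x \<in> U"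
  shows "\<exists>F. finite F \<and> F \<subseteq> S \<and> F \<noteq> {} \<and> x \<in> \<Inter>F \<and> \<Inter>F \<subseteq> U"
  using assms
proof (induction arbitrary: x)
  case (Int a b)
  obtain F where F: "finite F \<and> F \<subseteq> S \<and> F \<noteq> {} \<and> x \<in> \<Inter>F \<and> \<Inter>F \<subseteq> a"
    using Int.IH(1)[of x] Int.prems by auto
  obtain G where G: "finite G \<and> G \<subseteq> S \<and> G \<noteq> {} \<and> x \<in> \<Inter>G \<and> \<Inter>G \<subseteq> b"
    using Int.IH(2)[of x] Int.prems by auto
  have "\<Inter>(F \<union> G) \<subseteq> a \<inter> b"
    using F G by (simp add: Inter_Un_distrib le_infI1 le_infI2)
  then show ?case using F G by (intro exI[of _ "F \<union> G"]) (simp add: ball_Un)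
next
  case (UN K)
  then obtain k where k: "k \<in> K" "x \<in> k" by auto
  then obtain F where "finite F \<and> F \<subseteq> S \<and> F \<noteq> {} \<and> x \<in> \<Inter>F \<and> \<Inter>F \<subseteq> k"
    using UN.IH[OF k] by auto
  moreover have "k \<subseteq> \<Union>K" using k by auto
  ultimately show ?case by (intro exI[of _ F]) (simp add: order_trans[of _ k])
next
  case (Basis s)
  then show ?case by (intro exI[of _ "{s}"]) simp
qed simp

text \<open>
  The description of a generated topology as arbitrary unions of finite intersections, which is the
  form in which Alexander's subbase lemma expects it.
\<close>

lemma topology_generated_by_subbase:
  "topology (arbitrary union_of (finite intersection_of (\<lambda>x. x \<in> S) relative_to \<Union>S))
     = topology_generated_by S" (is "?L = ?R")
  unfolding topology_eq
proof (intro allI iffI)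
  fix U assume "openin ?L U"
  then have *: "(arbitrary union_of (finite intersection_of (\<lambda>x. x \<in> S) relative_to \<Union>S)) U"
    by (simp add: openin_subbase)
  have "openin ?R V" if V: "(finite intersection_of (\<lambda>x. x \<in> S) relative_to \<Union>S) V" for V
  proof -
    obtain W where W: "(finite intersection_of (\<lambda>x. x \<in> S)) W" "\<Union>S \<inter> W = V"
      using V unfolding relative_to_def by (elim exE conjE)
    then obtain F where "finite F" "F \<subseteq> Collect (\<lambda>x. x \<in> S)" "\<Inter>F = W"
      unfolding intersection_of_def by (elim exE conjE)
    then have F: "finite F" "F \<subseteq> S" "V = \<Union>S \<inter> \<Inter>F" using W by simp_all
    have "openin ?R (topspace ?R \<inter> \<Inter>F)"
      by (rule openin_Int_Inter) (use F in \<open>auto intro: topology_generated_by_Basis\<close>)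
    then show ?thesis by (simp add: F)
  qed
  moreover obtain K where "K \<subseteq> Collect (finite intersection_of (\<lambda>x. x \<in> S) relative_to \<Union>S)"
      "\<Union>K = U"
    using * unfolding union_of_def by (elim exE conjE)
  ultimately show "openin ?R U"
    using openin_Union[of K ?R] by (simp add: subset_iff)
next
  fix U assume "openin ?R U"
  then have "generate_topology_on S U" by (rule openin_topology_generated_by)
  then show "openin ?L U"
  proof induction
    case (Basis s)
    have "(finite intersection_of (\<lambda>x. x \<in> S) relative_to \<Union>S) s"
      unfolding relative_to_def intersection_of_def
      using Basis by (intro exI[of _ s] conjI exI[of _ "{s}"]) auto
    then show ?case
      by (simp add: openin_subbase arbitrary_union_of_inc)
  next
    case (UN K)
    then show ?case by (intro openin_Union) simp
  qed (simp_all add: openin_Int)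
qed

lemma second_countable_topology_generated_by:
  assumes "countable S"
  shows "second_countable (topology_generated_by S)"
  unfolding second_countable_def
proof (intro exI conjI ballI allI impI)
  let ?B = "Inter ` {F. finite F \<and> F \<subseteq> S \<and> F \<noteq> {}}"
  show "countable ?B"
    using countable_Collect_finite_subset[OF assms]
    by (intro countable_image) (rule countable_subset[rotated], auto)
  show "openin (topology_generated_by S) V" if "V \<in> ?B" for V
  proof -
    obtain F where F: "V = \<Inter>F" "F \<in> {F. finite F \<and> F \<subseteq> S \<and> F \<noteq> {}}"
      using \<open>V \<in> ?B\<close> by (rule imageE)
    have "openin (topology_generated_by S) (\<Inter>F)"
    proof (rule openin_Inter)
      show "openin (topology_generated_by S) X" if "X \<in> F" for X
        using that F(2) by (auto simp: subset_iff intro: topology_generated_by_Basis)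
    qed (use F(2) in simp_all)
    then show ?thesis using F(1) by simp
  qed
  show "\<exists>V\<in>?B. x \<in> V \<and> V \<subseteq> U" if "openin (topology_generated_by S) U \<and> x \<in> U" for U x
  proof -
    obtain F where "finite F \<and> F \<subseteq> S \<and> F \<noteq> {} \<and> x \<in> \<Inter>F \<and> \<Inter>F \<subseteq> U"
      using generate_topology_on_base[of S U x] \<open>openin _ U \<and> _\<close> openin_topology_generated_by[of S U]
      by auto
    then show ?thesis by (intro bexI[of _ "\<Inter>F"]) simp_all
  qed
qed

text \<open>
  The Borel sets of a subspace of a topology with a countable subbase are generated by the traces
  of the subbase.
\<close>

lemma borel_of_subset_of_subbase:
  assumes "countable S" "space M = topspace (subtopology (topology_generated_by S) Y)"
    and "\<And>s. s \<in> S \<Longrightarrow> s \<inter> space M \<in> sets M"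
  shows "sets (borel_of (subtopology (topology_generated_by S) Y)) \<subseteq> sets M"
proof (rule borel_of_subset_sets[OF assms(2)])
  fix W assume "openin (subtopology (topology_generated_by S) Y) W"
  then obtain U where U: "generate_topology_on S U" "W = U \<inter> Y"
    by (auto simp: openin_subtopology dest: openin_topology_generated_by)
  have "U \<subseteq> \<Union>S"
    using openin_subset[of "topology_generated_by S" U] U(1)
    by (simp add: openin_topology_generated_by_iff)
  then have W: "W = U \<inter> space M" using U assms(2) by auto
  let ?B = "{F. finite F \<and> F \<subseteq> S \<and> F \<noteq> {} \<and> \<Inter>F \<subseteq> U}"
  have "countable ?B"
    using countable_Collect_finite_subset[OF assms(1)] by (rule countable_subset[rotated]) auto
  moreover have "\<Inter>F \<inter> space M \<in> sets M" if "F \<in> ?B" for F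
  proof -
    have "(\<Inter>s\<in>F. s \<inter> space M) \<in> sets M"
      using that assms(3) by (intro sets.finite_INT) auto
    moreover have "(\<Inter>s\<in>F. s \<inter> space M) = \<Inter>F \<inter> space M" using that by auto
    ultimately show ?thesis by simp
  qed
  ultimately have "(\<Union>F\<in>?B. \<Inter>F \<inter> space M) \<in> sets M"
    by (intro sets.countable_UN') auto
  moreover have "(\<Union>F\<in>?B. \<Inter>F \<inter> space M) = W"
  proof (intro equalityI subsetI)
    fix x assume "x \<in> W"
    then have x: "x \<in> U" "x \<in> space M" using W by auto
    from generate_topology_on_base[OF U(1) x(1)]
    obtain F where "F \<in> ?B" "x \<in> \<Inter>F" by auto
    then show "x \<in> (\<Union>F\<in>?B. \<Inter>F \<inter> space M)" using x by blast
  qed (use W in auto)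
  ultimately show "W \<in> sets M" by simp
qed


section \<open>The Chabauty-Fell topology\<close>

lemma topspace_chabauty_fell [simp]: "topspace chabauty_fell = {F. closed F}"
proof -
  have "{F. closed F} \<in> {{F. closed F \<and> F \<inter> K = {}} | K. compact K}"
    by (auto intro!: exI[of _ "{}"])
  then show ?thesis
    unfolding chabauty_fell_def topology_generated_by_topspace by auto
qed

lemma openin_miss: "compact K \<Longrightarrow> openin chabauty_fell {F. closed F \<and> F \<inter> K = {}}"
  unfolding chabauty_fell_def by (rule topology_generated_by_Basis) auto

lemma openin_hit: "open U \<Longrightarrow> openin chabauty_fell {F. closed F \<and> F \<inter> U \<noteq> {}}"
  unfolding chabauty_fell_def by (rule topology_generated_by_Basis) auto

text \<open>
  Fell's theorem. By Alexander's lemma it suffices to treat a cover by subbasic sets: if \<open>V\<close> is the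
  union of the open sets \<open>U\<close> whose hit sets occur, then the closed set \<open>- V\<close> lies in a miss set of
  some compact \<open>K\<close>, so \<open>K \<subseteq> V\<close>, and finitely many of the \<open>U\<close> cover \<open>K\<close>.
\<close>

lemma compact_space_chabauty_fell:
  "compact_space (chabauty_fell :: 'a::topological_space set topology)"
proof (rule Alexander_subbase)
  let ?S = "{{F::'a set. closed F \<and> F \<inter> K = {}} | K. compact K} \<union>
      {{F. closed F \<and> F \<inter> U \<noteq> {}} | U. open U}"
  show "topology (arbitrary union_of (finite intersection_of (\<lambda>x. x \<in> ?S) relative_to \<Union>?S))
      = chabauty_fell"
    unfolding chabauty_fell_def by (rule topology_generated_by_subbase)
  fix C assume C: "C \<subseteq> ?S" "\<Union>C = topspace chabauty_fell"
  define D where "D = {U. open U \<and> {F. closed F \<and> F \<inter> U \<noteq> {}} \<in> C}"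
  have "closed (- \<Union>D)" by (auto simp: D_def)
  then have "- \<Union>D \<in> \<Union>C" using C(2) by simp
  then obtain s where s: "s \<in> C" "- \<Union>D \<in> s" by (rule UnionE)
  then have "s \<in> ?S" using C(1) by (simp add: subset_eq)
  then consider (miss) K where "compact K" "s = {F. closed F \<and> F \<inter> K = {}}"
    | (hit) U where "open U" "s = {F. closed F \<and> F \<inter> U \<noteq> {}}" by auto
  then show "\<exists>C'. finite C' \<and> C' \<subseteq> C \<and> \<Union>C' = topspace chabauty_fell"
  proof cases
    case hit
    then have "U \<in> D" using s by (simp add: D_def)
    with hit s show ?thesis by auto
  next
    case miss
    then have "K \<subseteq> \<Union>D" using s by auto
    moreover have "\<And>U. U \<in> D \<Longrightarrow> open U" by (simp add: D_def)
    ultimately obtain D' where D': "D' \<subseteq> D" "finite D'" "K \<subseteq> \<Union>D'"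
      using compactE[OF miss(1)] by metis
    let ?C = "insert s ((\<lambda>U. {F. closed F \<and> F \<inter> U \<noteq> {}}) ` D')"
    have "?C \<subseteq> C" using D' s by (auto simp: D_def)
    moreover have "topspace chabauty_fell \<subseteq> \<Union>?C"
    proof
      fix F :: "'a set" assume "F \<in> topspace chabauty_fell"
      then have F: "closed F" by simp
      show "F \<in> \<Union>?C"
      proof (cases "F \<inter> K = {}")
        case True
        then show ?thesis using F miss by simp
      next
        case False
        then obtain x U where "x \<in> F" "U \<in> D'" "x \<in> U" using D' by blast
        then show ?thesis using F by auto
      qed
    qed
    moreover have "\<Union>?C \<subseteq> topspace chabauty_fell"
      using Union_mono[OF \<open>?C \<subseteq> C\<close>] C(2) by simp
    moreover have "finite ?C" using D' by simp
    ultimately show ?thesis by (intro exI[of _ ?C] conjI) (simp_all only: subset_antisym)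
  qed
qed

text \<open>The hypothesis is local compactness, stated pointwise.\<close>

lemma Hausdorff_space_chabauty_fell:
  assumes "\<And>x (U :: 'a::t2_space set). open U \<Longrightarrow> x \<in> U \<Longrightarrow>
    \<exists>V K. open V \<and> compact K \<and> x \<in> V \<and> V \<subseteq> K \<and> K \<subseteq> U"
  shows "Hausdorff_space (chabauty_fell :: 'a set topology)"
proof -
  have sep: "\<exists>U V. openin chabauty_fell U \<and> openin chabauty_fell V \<and> E \<in> U \<and> F \<in> V \<and> disjnt U V"
    if EF: "closed E" "closed F" "x \<in> E" "x \<notin> F" for E F :: "'a set" and x
  proof -
    obtain V K where VK: "open V" "compact K" "x \<in> V" "V \<subseteq> K" "K \<subseteq> - F"
      using assms[of "- F" x] EF by auto
    show ?thesis
    proof (intro exI conjI)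
      show "openin chabauty_fell {F. closed F \<and> F \<inter> V \<noteq> {}}" by (rule openin_hit) fact
      show "openin chabauty_fell {F. closed F \<and> F \<inter> K = {}}" by (rule openin_miss) fact
      show "disjnt {F. closed F \<and> F \<inter> V \<noteq> {}} {F. closed F \<and> F \<inter> K = {}}"
        using VK(4) by (auto simp: disjnt_def)
    qed (use EF VK in auto)
  qed
  show ?thesis
    unfolding Hausdorff_space_def
  proof (intro allI impI, elim conjE)
    fix E F :: "'a set"
    assume *: "E \<in> topspace chabauty_fell" "F \<in> topspace chabauty_fell" "E \<noteq> F"
    then consider x where "x \<in> E" "x \<notin> F" | x where "x \<in> F" "x \<notin> E" by auto
    then show "\<exists>U V. openin chabauty_fell U \<and> openin chabauty_fell V \<and> E \<in> U \<and> F \<in> V \<and> disjnt U V"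
    proof cases
      case 1
      then show ?thesis using sep[of E F x] * by simp
    next
      case 2
      then obtain U V where "openin chabauty_fell U" "openin chabauty_fell V" "F \<in> U" "E \<in> V" "disjnt U V"
        using sep[of F E x] * by auto
      then show ?thesis by (intro exI[of _ V] exI[of _ U]) (simp add: disjnt_sym)
    qed
  qed
qed

lemma openin_topology_generated_by_mono:
  assumes "openin (topology_generated_by S) U" "\<And>s. s \<in> S \<Longrightarrow> openin T s"
  shows "openin T U"
proof -
  have "generate_topology_on S U" using assms(1) by (rule openin_topology_generated_by)
  then show ?thesis
  proof induction
    case (UN K)
    then show ?case by (intro openin_Union) simp
  qed (use assms(2) in \<open>simp_all add: openin_Int\<close>)
qed

text \<open>A countable subbase of the Chabauty-Fell topology of the real line.\<close>

definition rational_subbase :: "real set set set" where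
  "rational_subbase =
     (\<lambda>(a, b). {F. closed F \<and> F \<inter> {a..b} = {}}) ` (\<rat> \<times> \<rat>) \<union>
     (\<lambda>(a, b). {F. closed F \<and> F \<inter> {a<..<b} \<noteq> {}}) ` (\<rat> \<times> \<rat>)"

lemma countable_rational_subbase: "countable rational_subbase"
  unfolding rational_subbase_def by (intro countable_Un countable_image countable_SIGMA countable_rat)

lemma rational_interval:
  fixes U :: "real set"
  assumes "open U" "x \<in> U"
  obtains a b where "a \<in> \<rat>" "b \<in> \<rat>" "a < x" "x < b" "{a..b} \<subseteq> U"
proof -
  obtain e where e: "e > 0" "ball x e \<subseteq> U" using assms open_contains_ball by blast
  obtain a where a: "a \<in> \<rat>" "x - e < a" "a < x" using Rats_dense_in_real[of "x - e" x] e by auto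
  obtain b where b: "b \<in> \<rat>" "x < b" "b < x + e" using Rats_dense_in_real[of x "x + e"] e by auto
  have "{a..b} \<subseteq> ball x e" using a b by (auto simp: dist_real_def)
  then show ?thesis using that a b e by blast
qed

lemma chabauty_fell_real: "chabauty_fell = topology_generated_by rational_subbase"
  unfolding topology_eq
proof (intro allI iffI)
  fix W :: "real set set"
  assume "openin (topology_generated_by rational_subbase) W"
  then show "openin chabauty_fell W"
    by (rule openin_topology_generated_by_mono)
       (auto simp: rational_subbase_def intro: openin_miss openin_hit)
next
  let ?T = "topology_generated_by rational_subbase"
  have miss: "openin ?T {F. closed F \<and> F \<inter> {a..b} = {}}" if "a \<in> \<rat>" "b \<in> \<rat>" for a b :: real
    using that unfolding rational_subbase_def by (intro topology_generated_by_Basis) auto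
  have hit: "openin ?T {F. closed F \<and> F \<inter> {a<..<b} \<noteq> {}}" if "a \<in> \<rat>" "b \<in> \<rat>" for a b :: real
    using that unfolding rational_subbase_def by (intro topology_generated_by_Basis) auto
  have missK: "openin ?T {F. closed F \<and> F \<inter> K = {}}" if K: "compact K" for K :: "real set"
  proof (subst openin_subopen, intro ballI)
    fix F assume "F \<in> {F. closed F \<and> F \<inter> K = {}}"
    then have F: "closed F" "F \<inter> K = {}" by auto
    define I where "I = {(a, b). a \<in> \<rat> \<and> b \<in> \<rat> \<and> {a..b} \<subseteq> - F}"
    have "K \<subseteq> (\<Union>c\<in>I. {fst c<..<snd c})"
    proof
      fix x assume "x \<in> K"
      then obtain a b where "a \<in> \<rat>" "b \<in> \<rat>" "a < x" "x < b" "{a..b} \<subseteq> - F"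
        using rational_interval[of "- F" x] F by auto
      then have "(a, b) \<in> I" "x \<in> {fst (a, b)<..<snd (a, b)}" by (auto simp: I_def)
      then show "x \<in> (\<Union>c\<in>I. {fst c<..<snd c})" by (rule UN_I)
    qed
    then obtain J where J: "J \<subseteq> I" "finite J" "K \<subseteq> (\<Union>c\<in>J. {fst c<..<snd c})"
      using compactE_image[OF K, of I "\<lambda>c. {fst c<..<snd c}"] by auto
    let ?m = "\<lambda>c. {F. closed F \<and> F \<inter> {fst c..snd c} = {}}"
    \<comment> \<open>the set missing \<open>{1..0} = {}\<close> is the whole space; it keeps the family nonempty when \<open>J = {}\<close>\<close>
    have "openin ?T (\<Inter>(insert {F. closed F \<and> F \<inter> {1..0} = {}} (?m ` J)))"
    proof (rule openin_Inter)
      show "openin ?T X" if X: "X \<in> insert {F. closed F \<and> F \<inter> {1..0} = {}} (?m ` J)" for X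
        using X
      proof
        assume "X = {F. closed F \<and> F \<inter> {1..0} = {}}"
        then show ?thesis using miss[of 1 0] by simp
      next
        assume "X \<in> ?m ` J"
        then show ?thesis using miss J(1) by (auto simp: I_def)
      qed
    qed (use J in auto)
    moreover have "F \<inter> {fst c..snd c} = {}" if "c \<in> J" for c
    proof -
      have "c \<in> I" using that J(1) by (rule subsetD[rotated])
      then have "{fst c..snd c} \<subseteq> - F" by (simp add: I_def case_prod_unfold)
      then show ?thesis by blast
    qed
    then have "F \<in> \<Inter>(insert {F. closed F \<and> F \<inter> {1..0} = {}} (?m ` J))"
      using F by simp
    moreover have "\<Inter>(insert {F. closed F \<and> F \<inter> {1..0} = {}} (?m ` J)) \<subseteq> {F. closed F \<and> F \<inter> K = {}}"
    proof
      fix E assume E: "E \<in> \<Inter>(insert {F. closed F \<and> F \<inter> {1..0} = {}} (?m ` J))"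
      have False if x: "x \<in> E" "x \<in> K" for x
      proof -
        obtain c where c: "c \<in> J" "x \<in> {fst c<..<snd c}" using J(3) x by auto
        then have "E \<inter> {fst c..snd c} = {}" using E by auto
        then show False using c x by auto
      qed
      then show "E \<in> {F. closed F \<and> F \<inter> K = {}}" using E by auto
    qed
    ultimately show "\<exists>T. openin ?T T \<and> F \<in> T \<and> T \<subseteq> {F. closed F \<and> F \<inter> K = {}}"
      by (intro exI conjI)
  qed
  have hitU: "openin ?T {F. closed F \<and> F \<inter> U \<noteq> {}}" if U: "open U" for U :: "real set"
  proof (subst openin_subopen, intro ballI)
    fix F assume "F \<in> {F. closed F \<and> F \<inter> U \<noteq> {}}"
    then obtain x where F: "closed F" "x \<in> F" "x \<in> U" by auto
    obtain a b where ab: "a \<in> \<rat>" "b \<in> \<rat>" "a < x" "x < b" "{a..b} \<subseteq> U"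
      using rational_interval[of U x] U F by auto
    have "{a<..<b} \<subseteq> U" using ab by (auto simp: subset_iff)
    then show "\<exists>T. openin ?T T \<and> F \<in> T \<and> T \<subseteq> {F. closed F \<and> F \<inter> U \<noteq> {}}"
      using hit[OF ab(1,2)] F ab
      by (intro exI[of _ "{F. closed F \<and> F \<inter> {a<..<b} \<noteq> {}}"]) auto
  qed
  fix W :: "real set set"
  assume "openin chabauty_fell W"
  then show "openin ?T W"
    unfolding chabauty_fell_def
    by (rule openin_topology_generated_by_mono) (auto intro: missK hitU)
qed

lemma second_countable_hull_space: "second_countable (hull_space (P :: real set))"
  unfolding hull_space_def chabauty_fell_real
  by (intro second_countable_subtopology second_countable_topology_generated_by
      countable_rational_subbase)

lemma topspace_hull_space:
  "topspace (hull_space P) = chabauty_fell closure_of range (\<lambda>g. set_act g P)"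
  unfolding hull_space_def
  using closure_of_subset_topspace[of chabauty_fell] by auto

lemma closed_of_hull_space: "F \<in> topspace (hull_space P) \<Longrightarrow> closed F"
  using closure_of_subset_topspace[of chabauty_fell "range (\<lambda>g. set_act g P)"]
  by (auto simp: topspace_hull_space)

lemma openin_hull_space:
  "openin chabauty_fell W \<Longrightarrow> openin (hull_space P) {F \<in> topspace (hull_space P). F \<in> W}"
  unfolding hull_space_def openin_subtopology
  using closure_of_subset_topspace[of chabauty_fell "range (\<lambda>g. set_act g P)"]
  by (intro exI[of _ W]) auto

lemma compact_space_hull_space: "compact_space (hull_space P)"
  unfolding hull_space_def
  by (intro compact_space_subtopology closedin_compact_space compact_space_chabauty_fell closedin_closure_of)

text \<open>
  The sets of closed sets missing a compact set generate the Borel sets of the hull. A closed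
  set misses an open interval if and only if it misses each member of a sequence of compact intervals
  that exhausts it, so the sets hitting an open interval are generated as well.
\<close>

lemma hull_space_borel_generated:
  fixes P :: "real set"
  assumes sp: "space M = topspace (hull_space P)"
    and miss: "\<And>K. compact K \<Longrightarrow> {F \<in> topspace (hull_space P). F \<inter> K = {}} \<in> sets M"
  shows "sets (borel_of (hull_space P)) \<subseteq> sets M"
  unfolding hull_space_def chabauty_fell_real
proof (rule borel_of_subset_of_subbase[OF countable_rational_subbase])
  show "space M = topspace (subtopology (topology_generated_by rational_subbase)
      (topology_generated_by rational_subbase closure_of range (\<lambda>g. set_act g P)))"
    using sp unfolding hull_space_def chabauty_fell_real .
  have m: "{F. closed F \<and> F \<inter> {a..b} = {}} \<inter> space M \<in> sets M" for a b
  proof -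
    have "{F. closed F \<and> F \<inter> {a..b} = {}} \<inter> space M = {F \<in> topspace (hull_space P). F \<inter> {a..b} = {}}"
      using sp by (auto dest: closed_of_hull_space)
    then show ?thesis using miss[of "{a..b}"] by simp
  qed
  have h: "{F. closed F \<and> F \<inter> {a<..<b} \<noteq> {}} \<inter> space M \<in> sets M" for a b
  proof -
    have "{a<..<b} = (\<Union>n. {a + 1 / real (Suc n)..b - 1 / real (Suc n)})"
    proof (intro equalityI subsetI)
      fix x assume x: "x \<in> {a<..<b}"
      then obtain n where "1 / real (Suc n) < min (x - a) (b - x)"
        using nat_approx_posE[of "min (x - a) (b - x)"] by auto
      then show "x \<in> (\<Union>n. {a + 1 / real (Suc n)..b - 1 / real (Suc n)})"
        by (intro UN_I[of n]) auto
    next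
      fix x assume "x \<in> (\<Union>n. {a + 1 / real (Suc n)..b - 1 / real (Suc n)})"
      then obtain n where "a + 1 / real (Suc n) \<le> x" "x \<le> b - 1 / real (Suc n)" by auto
      moreover have "0 < 1 / real (Suc n)" by simp
      ultimately have "a < x" "x < b" by linarith+
      then show "x \<in> {a<..<b}" by simp
    qed
    then have "{F. closed F \<and> F \<inter> {a<..<b} \<noteq> {}} \<inter> space M
        = space M - (\<Inter>n. {F. closed F \<and> F \<inter> {a + 1 / real (Suc n)..b - 1 / real (Suc n)} = {}} \<inter> space M)"
      using sp by (auto dest: closed_of_hull_space)
    moreover have "(\<Inter>n. {F. closed F \<and> F \<inter> {a + 1 / real (Suc n)..b - 1 / real (Suc n)} = {}} \<inter> space M) \<in> sets M"
      by (rule sets.countable_INT) (use m in auto)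
    ultimately show ?thesis by simp
  qed
  show "s \<inter> space M \<in> sets M" if "s \<in> rational_subbase" for s
    using that unfolding rational_subbase_def
  proof
    assume "s \<in> (\<lambda>(a, b). {F. closed F \<and> F \<inter> {a..b} = {}}) ` (\<rat> \<times> \<rat>)"
    then obtain a b where "s = {F. closed F \<and> F \<inter> {a..b} = {}}" by auto
    then show ?thesis using m by simp
  next
    assume "s \<in> (\<lambda>(a, b). {F. closed F \<and> F \<inter> {a<..<b} \<noteq> {}}) ` (\<rat> \<times> \<rat>)"
    then obtain a b where "s = {F. closed F \<and> F \<inter> {a<..<b} \<noteq> {}}" by auto
    then show ?thesis using h by simp
  qed
qed

subsection \<open>The translation action of the line\<close>

lemma set_act_Int_eq_empty: "set_act t F \<inter> K = {} \<longleftrightarrow> F \<inter> (\<lambda>x. x + t) ` K = {}"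
proof
  assume *: "set_act t F \<inter> K = {}"
  have "k + t - t \<in> set_act t F" if "k + t \<in> F" for k
    unfolding set_act_def using that by (rule imageI)
  then show "F \<inter> (\<lambda>x. x + t) ` K = {}" using * by auto
next
  assume *: "F \<inter> (\<lambda>x. x + t) ` K = {}"
  have "x = (x - t) + t" for x by simp
  then show "set_act t F \<inter> K = {}" using * unfolding set_act_def by blast
qed

lemma set_act_0 [simp]: "set_act 0 F = F"
  by (simp add: set_act_def)

lemma set_act_add: "set_act s (set_act t F) = set_act (s + t) F"
  by (auto simp: set_act_def image_image diff_diff_eq2 diff_add_eq_diff_diff_swap)

lemma closed_set_act: "closed F \<Longrightarrow> closed (set_act t F)" for t :: real
  unfolding set_act_def using closed_translation_subtract[of F t] by simp

text \<open>
  Joint continuity. If \<open>F\<close> misses \<open>K + t\<close>, then it keeps a positive distance from it, so a whole compact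
  neighbourhood of \<open>K + t\<close> is missed, and with it \<open>K + s\<close> for \<open>s\<close> near \<open>t\<close>.
\<close>

lemma continuous_map_set_act:
  "continuous_map (prod_topology euclideanreal chabauty_fell) chabauty_fell (\<lambda>(t, F). set_act t F)"
    (is "continuous_map ?X _ ?f")
proof (subst chabauty_fell_def[where 'a=real], rule continuous_on_generated_topo)
  have missK: "openin ?X {z \<in> topspace ?X. ?f z \<inter> K = {}}" if K: "compact K" for K
  proof (subst openin_subopen, intro ballI)
    fix z assume "z \<in> {z \<in> topspace ?X. ?f z \<inter> K = {}}"
    then obtain t F where z: "z = (t, F)" "closed F" "F \<inter> (\<lambda>x. x + t) ` K = {}"
      by (auto simp: set_act_Int_eq_empty)
    let ?K = "(\<lambda>x. x + t) ` K"
    have K': "compact ?K" using K compact_translation[of K t] by (simp add: add.commute)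
    obtain d where d: "d > 0" "\<And>x y. x \<in> ?K \<Longrightarrow> y \<in> F \<Longrightarrow> d \<le> dist x y"
      using separate_compact_closed[OF K' z(2)] z(3) by blast
    let ?L = "{x + y |x y. x \<in> ?K \<and> y \<in> cball 0 (d/2)}"
    have L: "compact ?L" by (rule compact_sums[OF K' compact_cball])
    let ?T = "ball t (d/2) \<times> {F. closed F \<and> F \<inter> ?L = {}}"
    have "openin ?X ?T"
      by (intro openin_prod_Times_iff[THEN iffD2] disjI2 conjI openin_miss L) simp
    moreover have "z \<in> ?T"
    proof -
      have False if "x \<in> F" "x \<in> ?L" for x
      proof -
        obtain k y where "x = k + y" "k \<in> ?K" "\<bar>y\<bar> \<le> d/2" using \<open>x \<in> ?L\<close> by auto
        then show False using d(2)[of k x] d(1) that by (auto simp: dist_real_def)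
      qed
      then show ?thesis using z d by auto
    qed
    moreover have "?T \<subseteq> {z \<in> topspace ?X. ?f z \<inter> K = {}}"
    proof
      fix w assume "w \<in> ?T"
      then obtain s E where w: "w = (s, E)" "dist t s < d/2" "closed E" "E \<inter> ?L = {}" by auto
      have "E \<inter> (\<lambda>x. x + s) ` K = {}"
      proof (rule ccontr)
        assume "E \<inter> (\<lambda>x. x + s) ` K \<noteq> {}"
        then obtain k where k: "k \<in> K" "k + s \<in> E" by auto
        have "k + s = (k + t) + (s - t)" by simp
        moreover have "k + t \<in> ?K" "s - t \<in> cball 0 (d/2)" using k w by (auto simp: dist_real_def)
        ultimately have "k + s \<in> ?L" by blast
        then show False using k w by auto
      qed
      then show "w \<in> {z \<in> topspace ?X. ?f z \<inter> K = {}}"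
        using w by (simp add: set_act_Int_eq_empty)
    qed
    ultimately show "\<exists>T. openin ?X T \<and> z \<in> T \<and> T \<subseteq> {z \<in> topspace ?X. ?f z \<inter> K = {}}"
      by (intro exI conjI)
  qed
  have hitU: "openin ?X {z \<in> topspace ?X. ?f z \<inter> U \<noteq> {}}" if U: "open U" for U
  proof (subst openin_subopen, intro ballI)
    fix z assume "z \<in> {z \<in> topspace ?X. ?f z \<inter> U \<noteq> {}}"
    then obtain t F x where z: "z = (t, F)" "closed F" "x \<in> F" "x - t \<in> U"
      by (auto simp: set_act_def)
    obtain e where e: "e > 0" "ball (x - t) e \<subseteq> U" using U z open_contains_ball by blast
    let ?T = "ball t (e/2) \<times> {F. closed F \<and> F \<inter> ball x (e/2) \<noteq> {}}"
    have "openin ?X ?T"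
      by (intro openin_prod_Times_iff[THEN iffD2] disjI2 conjI openin_hit) simp_all
    moreover have "x \<in> F \<inter> ball x (e/2)" using z e by simp
    then have "z \<in> ?T" using z e by auto
    moreover have "?T \<subseteq> {z \<in> topspace ?X. ?f z \<inter> U \<noteq> {}}"
    proof
      fix w assume "w \<in> ?T"
      then obtain s E where w: "w = (s, E)" "s \<in> ball t (e/2)" "closed E" "E \<inter> ball x (e/2) \<noteq> {}"
        by (cases w) (simp del: mem_ball)
      then obtain y where y: "y \<in> E" "dist x y < e/2" by auto
      have "y - s \<in> ball (x - t) e" using w(2) y(2) unfolding mem_ball dist_real_def by linarith
      then have "y - s \<in> set_act s E \<inter> U" using e y by (auto simp: set_act_def)
      then show "w \<in> {z \<in> topspace ?X. ?f z \<inter> U \<noteq> {}}" using w by auto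
    qed
    ultimately show "\<exists>T. openin ?X T \<and> z \<in> T \<and> T \<subseteq> {z \<in> topspace ?X. ?f z \<inter> U \<noteq> {}}"
      by (intro exI conjI)
  qed
  fix W :: "real set set"
  assume "W \<in> {{F. closed F \<and> F \<inter> K = {}} |K. compact K} \<union> {{F. closed F \<and> F \<inter> U \<noteq> {}} |U. open U}"
  then consider (miss) K where "compact K" "W = {F. closed F \<and> F \<inter> K = {}}"
    | (hit) U where "open U" "W = {F. closed F \<and> F \<inter> U \<noteq> {}}" by auto
  then show "openin ?X (?f -` W \<inter> topspace ?X)"
  proof cases
    case miss
    then have "?f -` W \<inter> topspace ?X = {z \<in> topspace ?X. ?f z \<inter> K = {}}"
      by (auto simp: closed_set_act)
    then show ?thesis using missK miss by simp
  next
    case hit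
    then have "?f -` W \<inter> topspace ?X = {z \<in> topspace ?X. ?f z \<inter> U \<noteq> {}}"
      by (auto simp: closed_set_act)
    then show ?thesis using hitU hit by simp
  qed
next
  show "?f ` topspace ?X \<subseteq> \<Union> ({{F. closed F \<and> F \<inter> K = {}} |K. compact K} \<union>
      {{F. closed F \<and> F \<inter> U \<noteq> {}} |U. open U})"
    using topspace_chabauty_fell[where 'a=real]
    unfolding chabauty_fell_def topology_generated_by_topspace
    by (auto simp: closed_set_act)
qed

lemma set_act_hull_space:
  fixes t :: real
  assumes "F \<in> topspace (hull_space P)"
  shows "set_act t F \<in> topspace (hull_space P)"
proof -
  have "continuous_map chabauty_fell (prod_topology euclideanreal chabauty_fell) (\<lambda>F. (t, F))"
    by (intro continuous_map_pairedI continuous_map_const[THEN iffD2]) auto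
  then have "continuous_map chabauty_fell chabauty_fell ((\<lambda>(t, F). set_act t F) \<circ> (\<lambda>F. (t, F)))"
    using continuous_map_set_act by (rule continuous_map_compose)
  then have "continuous_map chabauty_fell chabauty_fell (set_act t)" by (simp add: comp_def)
  then have "set_act t ` (chabauty_fell closure_of range (\<lambda>g. set_act g P))
      \<subseteq> chabauty_fell closure_of (set_act t ` range (\<lambda>g. set_act g P))"
    by (rule continuous_map_image_closure_subset)
  also have "\<dots> \<subseteq> chabauty_fell closure_of range (\<lambda>g. set_act g P)"
    by (intro closure_of_mono) (auto simp: set_act_add)
  finally show ?thesis using assms by (auto simp: topspace_hull_space)
qed

lemma continuous_map_set_act_hull_space:
  "continuous_map (prod_topology euclideanreal (hull_space P)) (hull_space P) (\<lambda>(t, F). set_act t F)"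
proof -
  have "continuous_map (subtopology (prod_topology euclideanreal chabauty_fell)
      (UNIV \<times> topspace (hull_space P))) chabauty_fell (\<lambda>(t, F). set_act t F)"
    by (intro continuous_map_from_subtopology continuous_map_set_act)
  then show ?thesis
    using set_act_hull_space[of _ P]
    unfolding topspace_hull_space unfolding hull_space_def
    by (auto simp: continuous_map_in_subtopology subtopology_Times[symmetric] prod_topology_subtopology)
qed


section \<open>Bounded harmonic functions and central translations\<close>

lemma borel_measurable_translate:
  fixes g :: "'g::{group_add,discrete_topology} \<times> real"
  shows "(\<lambda>x. g + x) \<in> borel \<rightarrow>\<^sub>M borel"
proof (rule borel_measurable_continuous_onI)
  have "continuous_on UNIV (\<lambda>x::'g \<times> real. fst g + fst x)"
    by (rule continuous_on_compose2[of UNIV "\<lambda>y. fst g + y" UNIV fst])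
       (auto intro: Topological_Spaces.continuous_on_discrete continuous_on_fst continuous_on_id)
  then have "continuous_on UNIV (\<lambda>x::'g \<times> real. (fst g + fst x, snd g + snd x))"
    by (intro continuous_on_Pair continuous_intros)
  moreover have "(\<lambda>x. g + x) = (\<lambda>x. (fst g + fst x, snd g + snd x))"
    by (simp add: fun_eq_iff prod_eq_iff)
  ultimately show "continuous_on UNIV (\<lambda>x. g + x)" by simp
qed

text \<open>
  The heart of the Choquet-Deny argument: if a bounded harmonic function is almost maximal at \<open>g\<close>,
  then it is almost maximal at \<open>g + x\<close>, for each fixed \<open>x\<close> and uniformly in \<open>g\<close>. For \<open>x\<close> in the
  support of \<open>p\<close> this follows from averaging over a neighbourhood of \<open>x\<close>, and the set of such \<open>x\<close>
  is a semigroup.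
\<close>

lemma harmonic_near_maximum:
  fixes p :: "('g::{group_add,discrete_topology} \<times> real) measure"
  assumes p: "prob_space p" "sets p = sets borel"
    and gen: "semigroup_generated (measure_support p) = UNIV"
    and meas: "u \<in> borel_measurable borel"
    and bdd: "\<And>g. \<bar>u g\<bar> \<le> C" and le: "\<And>g. u g \<le> M"
    and harm: "\<And>g. u g = (\<integral>x. u (g + x) \<partial>p)"
    and lip: "\<And>\<gamma> t a. \<bar>u (\<gamma>, t + a) - u (\<gamma>, t)\<bar> \<le> L * \<bar>a\<bar>" "L \<ge> 0"
  shows "\<forall>\<epsilon>>0. \<exists>\<delta>>0. \<forall>g. M - \<delta> \<le> u g \<longrightarrow> M - \<epsilon> \<le> u (g + x)"
proof -
  interpret p: prob_space p by (rule p)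
  define S where "S = {x. \<forall>\<epsilon>>0. \<exists>\<delta>>0. \<forall>g. M - \<delta> \<le> u g \<longrightarrow> M - \<epsilon> \<le> u (g + x)}"
  have "x + y \<in> S" if "x \<in> S" "y \<in> S" for x y
    unfolding S_def
  proof (intro CollectI allI impI)
    fix \<epsilon> :: real assume "\<epsilon> > 0"
    then obtain \<delta>1 where 1: "\<delta>1 > 0" "\<And>g. M - \<delta>1 \<le> u g \<Longrightarrow> M - \<epsilon> \<le> u (g + y)"
      using \<open>y \<in> S\<close> unfolding S_def by blast
    then obtain \<delta> where "\<delta> > 0" "\<And>g. M - \<delta> \<le> u g \<Longrightarrow> M - \<delta>1 \<le> u (g + x)"
      using \<open>x \<in> S\<close> unfolding S_def by blast
    then show "\<exists>\<delta>>0. \<forall>g. M - \<delta> \<le> u g \<longrightarrow> M - \<epsilon> \<le> u (g + (x + y))"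
      using 1(2) by (metis add.assoc)
  qed
  moreover have "x \<in> S" if x: "x \<in> measure_support p" for x
    unfolding S_def
  proof (intro CollectI allI impI)
    fix \<epsilon> :: real assume e: "\<epsilon> > 0"
    \<comment> \<open>moving the real coordinate by less than \<open>r\<close> changes \<open>u\<close> by at most \<open>\<epsilon>/2\<close>\<close>
    define r where "r = \<epsilon> / (2 * (L + 1))"
    have r: "r > 0" "L * r \<le> \<epsilon> / 2" using e lip(2) by (auto simp: r_def field_simps)
    define U where "U = {fst x} \<times> ball (snd x) r"
    have U: "open U" "x \<in> U"
      using r by (simp_all add: U_def open_Times discrete_topology_class.open_discrete mem_Times_iff)
    then have "emeasure p U > 0" using x by (auto simp: measure_support_def)
    then have q: "measure p U > 0" by (simp add: p.emeasure_eq_measure)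
    have Um: "U \<in> sets p" using U p by simp
    show "\<exists>\<delta>>0. \<forall>g. M - \<delta> \<le> u g \<longrightarrow> M - \<epsilon> \<le> u (g + x)"
    proof (intro exI conjI allI impI)
      show "\<epsilon> * measure p U / 4 > 0" using q e by simp
      fix g assume g: "M - \<epsilon> * measure p U / 4 \<le> u g"
      show "M - \<epsilon> \<le> u (g + x)"
      proof (rule ccontr)
        assume "\<not> M - \<epsilon> \<le> u (g + x)"
        have *: "u (g + x') \<le> M - (\<epsilon> / 2) * indicator U x'" for x'
        proof (cases "x' \<in> U")
          case True
          then have x': "fst x' = fst x" "\<bar>snd x' - snd x\<bar> < r"
            by (auto simp: U_def dist_real_def)
          have "g + x' = (fst (g + x), snd (g + x) + (snd x' - snd x))"
            using x' by (simp add: prod_eq_iff)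
          then have "\<bar>u (g + x') - u (g + x)\<bar> \<le> L * \<bar>snd x' - snd x\<bar>"
            using lip(1)[of "fst (g + x)" "snd (g + x)" "snd x' - snd x"] by (simp only: prod.collapse)
          also have "\<dots> \<le> L * r" using x' lip(2) by (intro mult_left_mono) auto
          finally show ?thesis using r(2) True \<open>\<not> M - \<epsilon> \<le> u (g + x)\<close> by simp
        next
          case False
          then show ?thesis using le by simp
        qed
        have ind: "integrable p (\<lambda>x'. (\<epsilon> / 2) * indicator U x')"
          using Um by (intro integrable_mult_right integrable_real_indicator) (simp_all add: less_top[symmetric])
        have "u g = (\<integral>x'. u (g + x') \<partial>p)" by (rule harm)
        also have "\<dots> \<le> (\<integral>x'. M - (\<epsilon> / 2) * indicator U x' \<partial>p)"
        proof (rule integral_mono)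
          have "(\<lambda>x'. u (g + x')) \<in> borel_measurable p"
            using measurable_compose[OF borel_measurable_translate meas]
            by (simp add: measurable_cong_sets[OF p(2) refl])
          then show "integrable p (\<lambda>x'. u (g + x'))"
            by (intro p.integrable_const_bound[of _ C]) (auto simp: bdd)
          show "integrable p (\<lambda>x'. M - (\<epsilon> / 2) * indicator U x')"
            using ind by (intro Bochner_Integration.integrable_diff) simp_all
        qed (rule *)
        also have "\<dots> = M - (\<epsilon> / 2) * measure p U"
          using Um by (subst Bochner_Integration.integral_diff[OF _ ind]) (simp_all add: p.prob_space)
        finally show False using g q e mult_pos_pos[OF e q] by simp
      qed
    qed
  qed
  ultimately have "(\<lambda>S. \<forall>x\<in>S. \<forall>y\<in>S. x + y \<in> S) hull measure_support p \<subseteq> S"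
    by (intro hull_minimal) auto
  then have "x \<in> S" using gen unfolding semigroup_generated_def by auto
  then show ?thesis by (simp add: S_def)
qed

text \<open>
  If \<open>u g = h (g + z) - h g\<close> had a positive supremum \<open>M\<close>, then along \<open>g, g + z, g + 2z, \<dots>\<close> with
  \<open>u g\<close> close to \<open>M\<close> the increments of \<open>h\<close> would stay above \<open>M/2\<close> for as long as desired,
  contradicting boundedness. Centrality of \<open>z\<close> makes \<open>u\<close> harmonic.
\<close>

lemma harmonic_central_le:
  fixes p :: "('g::{group_add,discrete_topology} \<times> real) measure"
  assumes p: "prob_space p" "sets p = sets borel"
    and gen: "semigroup_generated (measure_support p) = UNIV"
    and meas: "h \<in> borel_measurable borel"
    and bdd: "\<And>g. \<bar>h g\<bar> \<le> C"
    and harm: "\<And>g. h g = (\<integral>x. h (g + x) \<partial>p)"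
    and lip: "\<And>\<gamma> t a. \<bar>h (\<gamma>, t + a) - h (\<gamma>, t)\<bar> \<le> L * \<bar>a\<bar>" "L \<ge> 0"
  shows "h (g0 + (0, s)) \<le> h g0"
proof (rule ccontr)
  interpret p: prob_space p by (rule p)
  define u where "u = (\<lambda>g. h (g + (0, s)) - h g)"
  define M where "M = (SUP g. u g)"
  assume "\<not> h (g0 + (0, s)) \<le> h g0"
  then have pos: "u g0 > 0" by (simp add: u_def)
  have ubdd: "\<bar>u g\<bar> \<le> 2 * C" for g
    using bdd[of g] bdd[of "g + (0, s)"] by (simp add: u_def)
  have bddu: "bdd_above (range u)"
    using ubdd by (intro bdd_aboveI[of _ "2 * C"]) (auto simp: abs_le_iff)
  have le: "u g \<le> M" for g
    unfolding M_def by (intro cSUP_upper bddu) simp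
  then have M: "M > 0" using pos by (meson less_le_trans)
  \<comment> \<open>only the real coordinate is translated, so this holds although \<open>\<Gamma>\<close> need not be abelian\<close>
  have comm: "g + (0, s) = (0, s) + g" for g :: "'g \<times> real"
    by (simp add: prod_eq_iff)
  have measu: "u \<in> borel_measurable borel"
    unfolding u_def comm using meas measurable_compose[OF borel_measurable_translate meas]
    by (intro borel_measurable_diff)
  have int: "integrable p (\<lambda>x. h (g + x))" for g
    using measurable_compose[OF borel_measurable_translate meas]
    by (intro p.integrable_const_bound[of _ C]) (auto simp: bdd measurable_cong_sets[OF p(2) refl])
  have harmu: "u g = (\<integral>x. u (g + x) \<partial>p)" for g
  proof -
    have *: "g + x + (0, s) = g + (0, s) + x" for x
      by (simp add: comm[of x] add.assoc)
    have "(\<integral>x. u (g + x) \<partial>p) = (\<integral>x. h (g + (0, s) + x) - h (g + x) \<partial>p)"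
      by (simp add: u_def *)
    also have "\<dots> = h (g + (0, s)) - h g"
      using int by (simp add: harm[symmetric])
    finally show ?thesis by (simp add: u_def)
  qed
  have lipu: "\<bar>u (\<gamma>, t + a) - u (\<gamma>, t)\<bar> \<le> (2 * L) * \<bar>a\<bar>" for \<gamma> t a
    using lip(1)[of \<gamma> "t + s" a] lip(1)[of \<gamma> t a] by (simp add: u_def algebra_simps)
  obtain N :: nat where N: "real N * (M / 2) > 2 * C"
    using reals_Archimedean3[of "M / 2"] M by (metis half_gt_zero)
  have "C \<ge> 0" using bdd[of g0] by linarith
  then have "N > 0" using N M by (cases N) auto
  have "\<forall>k. \<exists>\<delta>>0. \<forall>g. M - \<delta> \<le> u g \<longrightarrow> M - M / 2 \<le> u (g + (0, real k * s))"
  proof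
    fix k :: nat
    show "\<exists>\<delta>>0. \<forall>g. M - \<delta> \<le> u g \<longrightarrow> M - M / 2 \<le> u (g + (0, real k * s))"
    proof -
      have "2 * L \<ge> 0" "M / 2 > 0" using lip(2) M by simp_all
      with harmonic_near_maximum[OF p gen measu ubdd le harmu lipu, of "(0, real k * s)"]
      show ?thesis by blast
    qed
  qed
  then obtain \<delta> where \<delta>: "\<And>k. \<delta> k > 0"
    "\<And>k g. M - \<delta> k \<le> u g \<Longrightarrow> M - M / 2 \<le> u (g + (0, real k * s))"
    by metis
  define d where "d = Min (\<delta> ` {..<N})"
  have "d > 0" unfolding d_def using \<open>N > 0\<close> \<delta>(1) by (subst Min_gr_iff) auto
  then have "M - d < M" by simp
  then obtain g where g: "M - d < u g"
    unfolding M_def using less_cSUP_iff[OF _ bddu] by auto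
  have sum: "(\<Sum>k<n. u (g + (0, real k * s))) = h (g + (0, real n * s)) - h g" for n :: nat
  proof (induction n)
    case 0
    have "(0::'g, 0::real) = 0" by (simp add: zero_prod_def)
    then show ?case by simp
  next
    case (Suc n)
    have "g + (0, real n * s) + (0, s) = g + (0, real (Suc n) * s)"
      by (simp add: prod_eq_iff algebra_simps)
    then show ?case using Suc by (simp add: u_def)
  qed
  have "real N * (M / 2) \<le> (\<Sum>k<N. u (g + (0, real k * s)))"
  proof -
    have "M / 2 \<le> u (g + (0, real k * s))" if "k < N" for k
    proof -
      have "d \<le> \<delta> k" unfolding d_def using that by (intro Min_le) auto
      then show ?thesis using \<delta>(2)[of k g] g by simp
    qed
    then show ?thesis using sum_bounded_below[of "{..<N}" "M / 2"] by simp
  qed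
  also have "\<dots> \<le> 2 * C"
    unfolding sum using bdd[of g] bdd[of "g + (0, real N * s)"] by linarith
  finally show False using N by simp
qed

lemma harmonic_central_invariant:
  fixes p :: "('g::{group_add,discrete_topology} \<times> real) measure"
  assumes "prob_space p" "sets p = sets borel"
    and "semigroup_generated (measure_support p) = UNIV"
    and "h \<in> borel_measurable borel"
    and "\<And>g. \<bar>h g\<bar> \<le> C"
    and "\<And>g. h g = (\<integral>x. h (g + x) \<partial>p)"
    and "\<And>\<gamma> t a. \<bar>h (\<gamma>, t + a) - h (\<gamma>, t)\<bar> \<le> L * \<bar>a\<bar>" "L \<ge> 0"
  shows "h (g + (0, s)) = h g"
proof (rule antisym)
  show "h (g + (0, s)) \<le> h g" by (rule harmonic_central_le[OF assms])
  have "h (g + (0, s) + (0, - s)) \<le> h (g + (0, s))" by (rule harmonic_central_le[OF assms])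
  moreover have "g + (0, s) + (0, - s) = g" by (simp add: prod_eq_iff)
  ultimately show "h g \<le> h (g + (0, s))" by simp
qed

section \<open>Stationary measures are invariant under the centre\<close>

lemma stationary_probsD:
  assumes "\<eta> \<in> stationary_probs p act X"
  shows "prob_space \<eta>" "sets \<eta> = sets (borel_of X)" "space \<eta> = topspace X"
    "distr (p \<Otimes>\<^sub>M \<eta>) (borel_of X) (\<lambda>(g, x). act g x) = \<eta>"
proof -
  show *: "sets \<eta> = sets (borel_of X)"
    using assms by (auto simp: stationary_probs_def borel_probs_def)
  show "space \<eta> = topspace X" using sets_eq_imp_space_eq[OF *] by simp
qed (use assms in \<open>auto simp: stationary_probs_def borel_probs_def\<close>)

lemma stationary_integral:
  fixes f :: "'x \<Rightarrow> real"
  assumes p: "prob_space p" and \<eta>: "\<eta> \<in> stationary_probs p act X"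
    and act: "(\<lambda>(g, x). act g x) \<in> p \<Otimes>\<^sub>M borel_of X \<rightarrow>\<^sub>M borel_of X"
    and f: "f \<in> borel_measurable (borel_of X)" "\<And>x. \<bar>f x\<bar> \<le> C"
  shows "(\<integral>x. f x \<partial>\<eta>) = (\<integral>g. (\<integral>x. f (act g x) \<partial>\<eta>) \<partial>p)"
proof -
  note \<eta>' = stationary_probsD[OF \<eta>]
  interpret \<eta>: prob_space \<eta> by (rule \<eta>')
  interpret p: prob_space p by (rule p)
  interpret pair_prob_space p \<eta> ..
  have act': "(\<lambda>(g, x). act g x) \<in> p \<Otimes>\<^sub>M \<eta> \<rightarrow>\<^sub>M borel_of X"
    using act by (simp add: measurable_cong_sets[OF sets_pair_measure_cong[OF refl \<eta>'(2)] refl])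
  have "(\<integral>x. f x \<partial>\<eta>) = (\<integral>z. f (case z of (g, x) \<Rightarrow> act g x) \<partial>(p \<Otimes>\<^sub>M \<eta>))"
    by (subst \<eta>'(4)[symmetric]) (rule integral_distr[OF act' f(1)])
  also have "\<dots> = (\<integral>g. (\<integral>x. f (act g x) \<partial>\<eta>) \<partial>p)"
  proof -
    have "integrable (p \<Otimes>\<^sub>M \<eta>) (\<lambda>z. f (case z of (g, x) \<Rightarrow> act g x))"
      by (intro integrable_const_bound[of _ C] measurable_compose[OF act' f(1)]) (simp add: f(2))
    then show ?thesis
      using integral_fst'[of "\<lambda>z. f (case z of (g, x) \<Rightarrow> act g x)"] by simp
  qed
  finally show ?thesis .
qed

text \<open>
  The function \<open>h g = \<integral> f (g.x) d\<eta>(x)\<close> is bounded and harmonic, and since the line is central it is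
  Lipschitz in the real coordinate as soon as \<open>f\<close> is Lipschitz along the orbits of the line.
\<close>

lemma stationary_integral_central:
  fixes p :: "('g::{group_add,discrete_topology} \<times> real) measure" and f :: "'x \<Rightarrow> real"
  assumes p: "prob_space p" "sets p = sets borel"
    and gen: "semigroup_generated (measure_support p) = UNIV"
    and \<eta>: "\<eta> \<in> stationary_probs p act X"
    and act: "(\<lambda>(g, x). act g x) \<in> borel \<Otimes>\<^sub>M borel_of X \<rightarrow>\<^sub>M borel_of X"
    and act_0: "\<And>x. x \<in> topspace X \<Longrightarrow> act 0 x = x"
    and act_add: "\<And>g g' x. act (g + g') x = act g (act g' x)"
    and f: "f \<in> borel_measurable (borel_of X)" "\<And>x. \<bar>f x\<bar> \<le> C"
    and lip: "\<And>x a. x \<in> topspace X \<Longrightarrow> \<bar>f (act (0, a) x) - f x\<bar> \<le> L * \<bar>a\<bar>" "L \<ge> 0"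
  shows "(\<integral>x. f (act (0, s) x) \<partial>\<eta>) = (\<integral>x. f x \<partial>\<eta>)"
proof -
  note \<eta>' = stationary_probsD[OF \<eta>]
  interpret \<eta>: prob_space \<eta> by (rule \<eta>')
  interpret p: prob_space p by (rule p)
  have act_\<eta>: "(\<lambda>(g, x). act g x) \<in> borel \<Otimes>\<^sub>M \<eta> \<rightarrow>\<^sub>M borel_of X"
    using act by (simp add: measurable_cong_sets[OF sets_pair_measure_cong[OF refl \<eta>'(2)] refl])
  have act_p: "(\<lambda>(g, x). act g x) \<in> p \<Otimes>\<^sub>M borel_of X \<rightarrow>\<^sub>M borel_of X"
    using act by (simp add: measurable_cong_sets[OF sets_pair_measure_cong[OF p(2) refl] refl])
  have act_g: "act g \<in> borel_of X \<rightarrow>\<^sub>M borel_of X" for g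
    using measurable_Pair2[OF act, of g] by simp
  have act_space: "act g x \<in> topspace X" if "x \<in> topspace X" for g x
    using measurable_space[OF act_g] that by simp
  have f_\<eta>: "(\<lambda>x. f (act g x)) \<in> borel_measurable \<eta>" for g
    using measurable_compose[OF act_g f(1)] by (simp add: measurable_cong_sets[OF \<eta>'(2) refl])
  have int: "integrable \<eta> (\<lambda>x. f (act g x))" for g
    by (intro \<eta>.integrable_const_bound[of _ C] f_\<eta>) (simp add: f(2))
  define h where "h = (\<lambda>g. \<integral>x. f (act g x) \<partial>\<eta>)"
  have "h ((0, 0) + (0, s)) = h (0, 0)"
  proof (rule harmonic_central_invariant[OF p gen])
    have "(\<lambda>(g, x). f (act g x)) \<in> borel_measurable (borel \<Otimes>\<^sub>M \<eta>)"
      using measurable_compose[OF act_\<eta> f(1)] by (simp add: case_prod_unfold)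
    then show "h \<in> borel_measurable borel"
      unfolding h_def by (rule \<eta>.borel_measurable_lebesgue_integral)
    show "\<bar>h g\<bar> \<le> C" for g
    proof -
      have "\<bar>h g\<bar> \<le> (\<integral>x. \<bar>f (act g x)\<bar> \<partial>\<eta>)" unfolding h_def by (rule integral_abs_bound)
      also have "\<dots> \<le> (\<integral>x. C \<partial>\<eta>)"
        by (rule integral_mono) (use int f(2) in auto)
      finally show ?thesis by (simp add: \<eta>.prob_space)
    qed
    show "h g = (\<integral>x. h (g + x) \<partial>p)" for g
      unfolding h_def act_add
      by (rule stationary_integral[OF p(1) \<eta> act_p measurable_compose[OF act_g f(1)] f(2)])
    show "\<bar>h (\<gamma>, t + a) - h (\<gamma>, t)\<bar> \<le> L * \<bar>a\<bar>" for \<gamma> t a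
    proof -
      have eq: "act (\<gamma>, t + a) x = act (0, a) (act (\<gamma>, t) x)" for x
        using act_add[of "(0, a)" "(\<gamma>, t)" x] by (simp add: add.commute)
      have "\<bar>h (\<gamma>, t + a) - h (\<gamma>, t)\<bar>
          = \<bar>\<integral>x. f (act (\<gamma>, t + a) x) - f (act (\<gamma>, t) x) \<partial>\<eta>\<bar>"
        unfolding h_def using int by simp
      also have "\<dots> \<le> (\<integral>x. \<bar>f (act (\<gamma>, t + a) x) - f (act (\<gamma>, t) x)\<bar> \<partial>\<eta>)"
        by (rule integral_abs_bound)
      also have "\<dots> \<le> (\<integral>x. L * \<bar>a\<bar> \<partial>\<eta>)"
      proof (rule integral_mono)
        show "integrable \<eta> (\<lambda>x. \<bar>f (act (\<gamma>, t + a) x) - f (act (\<gamma>, t) x)\<bar>)"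
          using int by simp
        show "\<bar>f (act (\<gamma>, t + a) x) - f (act (\<gamma>, t) x)\<bar> \<le> L * \<bar>a\<bar>" if "x \<in> space \<eta>" for x
          using lip(1)[OF act_space] that unfolding eq \<eta>'(3) by simp
      qed simp
      finally show ?thesis by (simp add: \<eta>.prob_space)
    qed
  qed (rule lip(2))
  moreover have "h (0, 0) = (\<integral>x. f x \<partial>\<eta>)"
    unfolding h_def by (rule Bochner_Integration.integral_cong)
      (simp_all add: \<eta>'(3) act_0 flip: zero_prod_def)
  ultimately show ?thesis by (simp add: h_def)
qed


section \<open>Smoothed miss functions on the hull\<close>

text \<open>
  For nonnegative \<open>\<psi>\<close> this is \<open>min 1 (inf\<^bsub>x \<in> F\<^esub> \<psi> x)\<close>, with value \<open>1\<close> for \<open>F = {}\<close>. With \<open>\<psi> x\<close> a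
  large multiple of the distance from \<open>x\<close> to a compact set \<open>K\<close> it is a Lipschitz approximation of the
  indicator of the sets that miss \<open>K\<close>.
\<close>

definition soft_miss :: "('a \<Rightarrow> real) \<Rightarrow> 'a set \<Rightarrow> real" where
  "soft_miss \<psi> F = Inf (insert 1 (\<psi> ` F))"

context
  fixes \<psi> :: "'a \<Rightarrow> real"
  assumes nonneg: "\<And>x. \<psi> x \<ge> 0"
begin

lemma bdd_below_soft_miss: "bdd_below (insert 1 (\<psi> ` F))"
  using nonneg by (intro bdd_belowI[of _ 0]) auto

lemma soft_miss_nonneg: "0 \<le> soft_miss \<psi> F"
  unfolding soft_miss_def using nonneg by (intro cInf_greatest) auto

lemma soft_miss_le_1: "soft_miss \<psi> F \<le> 1"
  unfolding soft_miss_def by (intro cInf_lower bdd_below_soft_miss) simp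

lemma abs_soft_miss_le_1: "\<bar>soft_miss \<psi> F\<bar> \<le> 1"
  using soft_miss_nonneg soft_miss_le_1 by simp

lemma soft_miss_le: "x \<in> F \<Longrightarrow> soft_miss \<psi> F \<le> \<psi> x"
  unfolding soft_miss_def by (intro cInf_lower bdd_below_soft_miss) simp

lemma soft_miss_less_iff: "soft_miss \<psi> F < r \<longleftrightarrow> 1 < r \<or> F \<inter> {x. \<psi> x < r} \<noteq> {}"
  unfolding soft_miss_def using cInf_less_iff[OF _ bdd_below_soft_miss, of F r] by auto

lemma le_soft_miss: "r \<le> 1 \<Longrightarrow> (\<And>x. x \<in> F \<Longrightarrow> r \<le> \<psi> x) \<Longrightarrow> r \<le> soft_miss \<psi> F"
  unfolding soft_miss_def by (intro cInf_greatest) auto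

end

lemma soft_miss_Lipschitz:
  fixes \<psi> :: "real \<Rightarrow> real"
  assumes nonneg: "\<And>x. \<psi> x \<ge> 0" and lip: "\<And>x y. \<bar>\<psi> x - \<psi> y\<bar> \<le> L * \<bar>x - y\<bar>"
  shows "\<bar>soft_miss \<psi> (set_act a F) - soft_miss \<psi> F\<bar> \<le> L * \<bar>a\<bar>"
proof -
  \<comment> \<open>the hypothesis forces \<open>L \<ge> 0\<close>\<close>
  have "L * 1 \<ge> 0" using lip[of 1 0] by simp
  then have La: "L * \<bar>a\<bar> \<ge> 0" for a by simp
  have *: "soft_miss \<psi> F - L * \<bar>a\<bar> \<le> soft_miss \<psi> (set_act a F)" for a F
  proof (rule le_soft_miss[OF nonneg])
    show "soft_miss \<psi> F - L * \<bar>a\<bar> \<le> 1" using La[of a] soft_miss_le_1[of \<psi> F, OF nonneg] by linarith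
    fix y assume "y \<in> set_act a F"
    then obtain x where x: "x \<in> F" "y = x - a" by (auto simp: set_act_def)
    have "soft_miss \<psi> F \<le> \<psi> x" by (rule soft_miss_le[OF nonneg x(1)])
    then show "soft_miss \<psi> F - L * \<bar>a\<bar> \<le> \<psi> y" using lip[of x y] x(2) by simp
  qed
  from *[of F a] *[of "set_act a F" "- a"] show ?thesis by (simp add: set_act_add)
qed

lemma borel_measurable_soft_miss:
  fixes \<psi> :: "real \<Rightarrow> real"
  assumes nonneg: "\<And>x. \<psi> x \<ge> 0" and cont: "continuous_on UNIV \<psi>"
  shows "soft_miss \<psi> \<in> borel_measurable (borel_of (hull_space P))"
proof (subst borel_measurable_iff_less, intro allI)
  fix r
  have "open {x. \<psi> x < r}" using cont by (intro open_Collect_less continuous_intros)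
  then have "openin (hull_space P) {F \<in> topspace (hull_space P). F \<in> {F. closed F \<and> F \<inter> {x. \<psi> x < r} \<noteq> {}}}"
    by (intro openin_hull_space openin_hit)
  then have "{F \<in> topspace (hull_space P). F \<inter> {x. \<psi> x < r} \<noteq> {}} \<in> sets (borel_of (hull_space P))"
    using openin_borel_of by (simp add: closed_of_hull_space cong: conj_cong)
  moreover have "topspace (hull_space P) \<in> sets (borel_of (hull_space P))"
    by (rule openin_borel_of) simp
  ultimately show "{F \<in> space (borel_of (hull_space P)). soft_miss \<psi> F < r} \<in> sets (borel_of (hull_space P))"
    by (cases "1 < r") (simp_all add: soft_miss_less_iff[OF nonneg])
qed

lemma soft_miss_tendsto_indicator:
  fixes F K :: "real set"
  assumes "closed F" "compact K" "K \<noteq> {}"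
  shows "(\<lambda>n. soft_miss (\<lambda>x. real n * infdist x K) F) \<longlonglongrightarrow> indicator {F. F \<inter> K = {}} F"
proof (cases "F \<inter> K = {}")
  case True
  then obtain d where d: "d > 0" "\<And>x y. x \<in> K \<Longrightarrow> y \<in> F \<Longrightarrow> d \<le> dist x y"
    using separate_compact_closed[OF assms(2,1)] by blast
  have far: "d \<le> infdist y K" if "y \<in> F" for y
    unfolding infdist_def using assms(3) d(2)[OF _ that] by (auto intro!: cINF_greatest simp: dist_commute)
  obtain N :: nat where N: "1 < real N * d" using reals_Archimedean3[OF d(1)] by blast
  have "soft_miss (\<lambda>x. real n * infdist x K) F = 1" if "n \<ge> N" for n
  proof (rule antisym)
    show "1 \<le> soft_miss (\<lambda>x. real n * infdist x K) F"
    proof (rule le_soft_miss)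
      fix x assume "x \<in> F"
      have "1 \<le> real N * d" using N by simp
      also have "\<dots> \<le> real n * infdist x K"
        using far[OF \<open>x \<in> F\<close>] that d(1) by (intro mult_mono) auto
      finally show "1 \<le> real n * infdist x K" .
    qed (simp_all add: infdist_nonneg)
  qed (rule soft_miss_le_1, simp add: infdist_nonneg)
  then show ?thesis using True by (intro tendsto_eventually eventually_sequentiallyI[of N]) simp
next
  case False
  then obtain x where x: "x \<in> F" "x \<in> K" by auto
  have "soft_miss (\<lambda>x. real n * infdist x K) F = 0" for n
    using soft_miss_le[of "\<lambda>x. real n * infdist x K" x F] soft_miss_nonneg[of "\<lambda>x. real n * infdist x K" F]
      x by (simp add: infdist_nonneg)
  then show ?thesis using False by simp
qed

section \<open>Measures on the product that are invariant in the second factor\<close>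

text \<open>
  If all the measures \<open>\<eta> (B \<times> \<cdot>)\<close> are invariant under the line, then unique ergodicity makes each of
  them a multiple of \<open>\<theta>\<close>.
\<close>

lemma product_measure_of_fibrewise_invariant:
  fixes P :: "real set" and Y :: "'y topology"
  assumes \<eta>: "prob_space \<eta>" "sets \<eta> = sets (borel_of Y \<Otimes>\<^sub>M borel_of (hull_space P))"
    and inv: "\<And>B K s. B \<in> sets (borel_of Y) \<Longrightarrow> compact K \<Longrightarrow>
        measure \<eta> (B \<times> {F \<in> topspace (hull_space P). set_act s F \<inter> K = {}})
        = measure \<eta> (B \<times> {F \<in> topspace (hull_space P). F \<inter> K = {}})"
    and ue: "uniquely_ergodic set_act (hull_space P)"
    and \<theta>: "\<theta> \<in> invariant_probs set_act (hull_space P)"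
  shows "\<eta> = distr \<eta> (borel_of Y) fst \<Otimes>\<^sub>M \<theta>"
proof -
  let ?\<Omega> = "hull_space P"
  interpret \<eta>: prob_space \<eta> by (rule \<eta>)
  have \<theta>': "prob_space \<theta>" "sets \<theta> = sets (borel_of ?\<Omega>)"
    using \<theta> by (auto simp: invariant_probs_def borel_probs_def)
  interpret \<theta>: prob_space \<theta> by (rule \<theta>')
  have sp: "space \<eta> = topspace Y \<times> topspace ?\<Omega>"
    using sets_eq_imp_space_eq[OF \<eta>(2)] by (simp add: space_pair_measure)
  have fst: "fst \<in> \<eta> \<rightarrow>\<^sub>M borel_of Y" and snd: "snd \<in> \<eta> \<rightarrow>\<^sub>M borel_of ?\<Omega>"
    by (simp_all add: measurable_cong_sets[OF \<eta>(2) refl])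
  interpret \<nu>: prob_space "distr \<eta> (borel_of Y) fst" by (rule \<eta>.prob_space_distr[OF fst])
  have rect: "B \<times> A \<in> sets \<eta>" if "B \<in> sets (borel_of Y)" "A \<in> sets (borel_of ?\<Omega>)" for A B
    using that by (simp add: \<eta>(2))
  have act: "set_act s \<in> borel_of ?\<Omega> \<rightarrow>\<^sub>M borel_of ?\<Omega>" for s
  proof (rule measurable_continuous_map)
    have "continuous_map ?\<Omega> (prod_topology euclideanreal ?\<Omega>) (\<lambda>F. (s, F))"
      by (intro continuous_map_pairedI continuous_map_const[THEN iffD2]) auto
    from continuous_map_compose[OF this continuous_map_set_act_hull_space]
    show "continuous_map ?\<Omega> ?\<Omega> (set_act s)" by (simp add: comp_def)
  qed
  have miss: "{F \<in> topspace ?\<Omega>. F \<inter> K = {}} \<in> sets (borel_of ?\<Omega>)" if "compact K" for K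
    using openin_borel_of[OF openin_hull_space[OF openin_miss[OF that], of P]]
    by (simp add: closed_of_hull_space cong: conj_cong)
  have main: "emeasure \<eta> (B \<times> A) = emeasure \<eta> (B \<times> topspace ?\<Omega>) * emeasure \<theta> A"
    if B: "B \<in> sets (borel_of Y)" and A: "A \<in> sets (borel_of ?\<Omega>)" for A B
  proof -
    \<comment> \<open>the measure \<open>A \<mapsto> \<eta> (B \<times> A)\<close> on the hull\<close>
    define N where "N = distr (restrict_space \<eta> (B \<times> topspace ?\<Omega>)) (borel_of ?\<Omega>) snd"
    have B\<Omega>: "B \<times> topspace ?\<Omega> \<in> sets \<eta>"
      by (intro rect B openin_borel_of) simp
    have setsN [measurable_cong]: "sets N = sets (borel_of ?\<Omega>)" by (simp add: N_def)
    have spN: "space N = topspace ?\<Omega>" by (simp add: N_def)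
    have BY: "B \<subseteq> topspace Y" using sets.sets_into_space[OF B] by simp
    have N: "emeasure N A = emeasure \<eta> (B \<times> A)" if A: "A \<in> sets (borel_of ?\<Omega>)" for A
    proof -
      have A\<Omega>: "A \<subseteq> topspace ?\<Omega>" using sets.sets_into_space[OF A] by simp
      have "emeasure N A = emeasure (restrict_space \<eta> (B \<times> topspace ?\<Omega>))
          (snd -` A \<inter> space (restrict_space \<eta> (B \<times> topspace ?\<Omega>)))"
        unfolding N_def by (rule emeasure_distr[OF measurable_restrict_space1[OF snd] A])
      also have "snd -` A \<inter> space (restrict_space \<eta> (B \<times> topspace ?\<Omega>)) = B \<times> A"
        using BY A\<Omega> by (auto simp: space_restrict_space sp)
      also have "emeasure (restrict_space \<eta> (B \<times> topspace ?\<Omega>)) (B \<times> A) = emeasure \<eta> (B \<times> A)"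
        using B\<Omega> A\<Omega> by (intro emeasure_restrict_space) (auto simp: sets.Int_space_eq2)
      finally show ?thesis .
    qed
    have distrN: "distr N (borel_of ?\<Omega>) (set_act s) = N" for s
    proof (rule measure_eqI_generator_eq[symmetric])
      let ?E = "(\<lambda>K. {F \<in> topspace ?\<Omega>. F \<inter> K = {}}) ` {K. compact K}"
      show "Int_stable ?E"
      proof (rule Int_stableI)
        fix a b assume "a \<in> ?E" "b \<in> ?E"
        then obtain K K' where K: "compact K" "a = {F \<in> topspace ?\<Omega>. F \<inter> K = {}}"
          and K': "compact K'" "b = {F \<in> topspace ?\<Omega>. F \<inter> K' = {}}"
          by (elim imageE) simp
        have "a \<inter> b = {F \<in> topspace ?\<Omega>. F \<inter> (K \<union> K') = {}}" using K K' by auto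
        then show "a \<inter> b \<in> ?E" by (rule image_eqI) (use K K' in auto)
      qed
      show "?E \<subseteq> Pow (topspace ?\<Omega>)" by auto
      have gen: "sets (borel_of ?\<Omega>) = sigma_sets (topspace ?\<Omega>) ?E"
      proof
        have "sets (borel_of ?\<Omega>) \<subseteq> sets (sigma (topspace ?\<Omega>) ?E)"
          by (rule hull_space_borel_generated) (auto simp: space_measure_of_conv)
        also have "\<dots> = sigma_sets (topspace ?\<Omega>) ?E" by (rule sets_measure_of) auto
        finally show "sets (borel_of ?\<Omega>) \<subseteq> sigma_sets (topspace ?\<Omega>) ?E" .
        have "?E \<subseteq> sets (borel_of ?\<Omega>)" using miss by auto
        then show "sigma_sets (topspace ?\<Omega>) ?E \<subseteq> sets (borel_of ?\<Omega>)"
          using sets.sigma_sets_subset[of ?E "borel_of ?\<Omega>"] by simp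
      qed
      show "sets N = sigma_sets (topspace ?\<Omega>) ?E" using gen setsN by simp
      show "sets (distr N (borel_of ?\<Omega>) (set_act s)) = sigma_sets (topspace ?\<Omega>) ?E"
        using gen by simp
      show "emeasure N X = emeasure (distr N (borel_of ?\<Omega>) (set_act s)) X" if "X \<in> ?E" for X
      proof -
        obtain K where K: "compact K" and X: "X = {F \<in> topspace ?\<Omega>. F \<inter> K = {}}"
          using \<open>X \<in> ?E\<close> by (elim imageE) simp
        have Xm: "X \<in> sets (borel_of ?\<Omega>)" unfolding X by (rule miss[OF K])
        have pre: "set_act s -` X \<inter> topspace ?\<Omega> = {F \<in> topspace ?\<Omega>. set_act s F \<inter> K = {}}"
          unfolding X using set_act_hull_space by auto
        have "emeasure (distr N (borel_of ?\<Omega>) (set_act s)) X = emeasure N (set_act s -` X \<inter> space N)"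
          by (rule emeasure_distr[OF _ Xm]) (simp add: measurable_cong_sets[OF setsN refl] act)
        also have "\<dots> = emeasure \<eta> (B \<times> {F \<in> topspace ?\<Omega>. set_act s F \<inter> K = {}})"
          using measurable_sets[OF act Xm, of s] by (subst N) (simp_all add: spN pre)
        also have "\<dots> = emeasure \<eta> (B \<times> {F \<in> topspace ?\<Omega>. F \<inter> K = {}})"
          using inv[OF B K, of s] by (simp add: \<eta>.emeasure_eq_measure)
        also have "\<dots> = emeasure N X" unfolding X by (rule N[symmetric, OF miss[OF K]])
        finally show ?thesis by simp
      qed
      have top: "topspace ?\<Omega> \<in> ?E" by (rule image_eqI[of _ _ "{}"]) auto
      show "range (\<lambda>_::nat. topspace ?\<Omega>) \<subseteq> ?E" using top by auto
      show "emeasure N (topspace ?\<Omega>) \<noteq> \<infinity>"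
        by (subst N) (auto intro: openin_borel_of)
    qed auto
    let ?m = "emeasure \<eta> (B \<times> topspace ?\<Omega>)"
    have m_fin: "?m \<noteq> \<top>" by simp
    show ?thesis
    proof (cases "?m = 0")
      case True
      have "B \<times> A \<subseteq> B \<times> topspace ?\<Omega>" using sets.sets_into_space[OF A] by auto
      then have "emeasure \<eta> (B \<times> A) = 0" using emeasure_mono[OF _ B\<Omega>, of "B \<times> A"] True by simp
      then show ?thesis using True by simp
    next
      case False
      define N' where "N' = scale_measure (1 / ?m) N"
      have N': "emeasure N' X = emeasure N X / ?m" for X
        by (simp add: N'_def divide_ennreal_def mult.commute)
      have setsN': "sets N' = sets (borel_of ?\<Omega>)" by (simp add: N'_def setsN)
      have spN': "space N' = topspace ?\<Omega>" using sets_eq_imp_space_eq[OF setsN'] by simp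
      have "N' \<in> invariant_probs set_act ?\<Omega>"
        unfolding invariant_probs_def borel_probs_def
      proof (intro CollectI conjI allI)
        have "emeasure N (topspace ?\<Omega>) = ?m" by (rule N[OF openin_borel_of]) simp
        moreover have "?m / ?m = 1"
          using False m_fin by (intro ennreal_divide_self) (simp_all add: less_top[symmetric])
        ultimately show "prob_space N'"
          by (intro prob_spaceI) (simp add: N' spN')
        show "sets N' = sets (borel_of ?\<Omega>)" by (rule setsN')
        show "distr N' (borel_of ?\<Omega>) (set_act s) = N'" for s
        proof (rule measure_eqI)
          fix X assume "X \<in> sets (distr N' (borel_of ?\<Omega>) (set_act s))"
          then have X: "X \<in> sets (borel_of ?\<Omega>)" by simp
          have "emeasure (distr N' (borel_of ?\<Omega>) (set_act s)) X = emeasure N' (set_act s -` X \<inter> space N')"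
            by (rule emeasure_distr[OF _ X]) (simp add: measurable_cong_sets[OF setsN' refl] act)
          also have "\<dots> = emeasure (distr N (borel_of ?\<Omega>) (set_act s)) X / ?m"
            by (subst emeasure_distr[OF _ X])
              (simp_all add: N' measurable_cong_sets[OF setsN refl] act spN spN')
          finally show "emeasure (distr N' (borel_of ?\<Omega>) (set_act s)) X = emeasure N' X"
            by (simp add: distrN N')
        qed (simp add: setsN')
      qed
      then have "N' = \<theta>" using ue \<theta> unfolding uniquely_ergodic_def by blast
      then have "emeasure \<theta> A = emeasure \<eta> (B \<times> A) / ?m" using N'[of A] N[OF A] by simp
      then show ?thesis using False m_fin by (simp add: ennreal_mult_divide_eq ennreal_times_divide mult.commute)
    qed
  qed
  show ?thesis
  proof (rule pair_measure_eqI[symmetric])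
    show "sigma_finite_measure (distr \<eta> (borel_of Y) fst)" ..
    show "sigma_finite_measure \<theta>" ..
    show "sets (distr \<eta> (borel_of Y) fst \<Otimes>\<^sub>M \<theta>) = sets \<eta>"
      unfolding \<eta>(2) by (rule sets_pair_measure_cong) (simp_all add: \<theta>')
    fix B A assume "B \<in> sets (distr \<eta> (borel_of Y) fst)" "A \<in> sets \<theta>"
    then have BA: "B \<in> sets (borel_of Y)" "A \<in> sets (borel_of ?\<Omega>)" by (simp_all add: \<theta>')
    have "B \<subseteq> topspace Y" using sets.sets_into_space[OF BA(1)] by simp
    then have "fst -` B \<inter> space \<eta> = B \<times> topspace ?\<Omega>" by (auto simp: sp)
    then show "emeasure (distr \<eta> (borel_of Y) fst) B * emeasure \<theta> A = emeasure \<eta> (B \<times> A)"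
      using main[OF BA] by (simp add: emeasure_distr[OF fst BA(1)])
  qed
qed


section \<open>The orbit closure of a quasimorphism\<close>

lemma fun_act_add: "fun_act (g + h) \<phi> = fun_act g (fun_act h \<phi>)"
  by (simp add: fun_act_def fun_eq_iff add.assoc)

lemma fun_act_0: "\<phi> 0 = 0 \<Longrightarrow> fun_act 0 \<phi> = \<phi>"
  by (simp add: fun_act_def)

lemma topspace_pointed_functions [simp]: "topspace pointed_functions = {\<phi>. \<phi> 0 = 0}"
  by (simp add: pointed_functions_def)

lemma topspace_orbit_closure_space:
  "topspace (orbit_closure_space \<phi>) = pointed_functions closure_of range (\<lambda>g. fun_act g \<phi>)"
  unfolding orbit_closure_space_def
  using closure_of_subset_topspace[of pointed_functions "range (\<lambda>g. fun_act g \<phi>)"] by auto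

lemma pointed_of_orbit_closure_space: "\<psi> \<in> topspace (orbit_closure_space \<phi>) \<Longrightarrow> \<psi> 0 = 0"
  using closure_of_subset_topspace[of pointed_functions "range (\<lambda>g. fun_act g \<phi>)"]
  by (auto simp: topspace_orbit_closure_space)

lemma continuous_map_eval_pointed: "continuous_map pointed_functions euclideanreal (\<lambda>\<phi>. \<phi> g)"
  unfolding pointed_functions_def
  by (intro continuous_map_from_subtopology) (simp add: continuous_on_product_coordinates)

lemma continuous_map_eval_orbit_closure_space:
  "continuous_map (orbit_closure_space \<phi>) euclideanreal (\<lambda>\<psi>. \<psi> g)"
  unfolding orbit_closure_space_def
  by (intro continuous_map_from_subtopology continuous_map_eval_pointed)

lemma continuous_map_fun_act_pointed: "continuous_map pointed_functions pointed_functions (fun_act g)"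
proof -
  have "continuous_on UNIV (fun_act g)"
    unfolding fun_act_def
    by (intro continuous_on_coordinatewise_then_product continuous_on_diff continuous_on_product_coordinates)
  then have "continuous_map (subtopology euclidean {\<phi>. \<phi> 0 = 0}) euclidean (fun_act g)"
    by (intro continuous_map_from_subtopology) simp
  moreover have "fun_act g \<phi> 0 = 0" for \<phi> by (simp add: fun_act_def)
  ultimately show ?thesis
    unfolding pointed_functions_def by (simp add: continuous_map_in_subtopology image_subset_iff)
qed

lemma fun_act_orbit_closure_space:
  assumes "\<psi> \<in> topspace (orbit_closure_space \<phi>)"
  shows "fun_act g \<psi> \<in> topspace (orbit_closure_space \<phi>)"
proof -
  have "fun_act g ` (pointed_functions closure_of range (\<lambda>g. fun_act g \<phi>))
      \<subseteq> pointed_functions closure_of (fun_act g ` range (\<lambda>g. fun_act g \<phi>))"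
    by (rule continuous_map_image_closure_subset[OF continuous_map_fun_act_pointed])
  also have "\<dots> \<subseteq> pointed_functions closure_of range (\<lambda>g. fun_act g \<phi>)"
    by (intro closure_of_mono) (auto simp flip: fun_act_add)
  finally show ?thesis using assms by (auto simp: topspace_orbit_closure_space)
qed

lemma continuous_map_fun_act:
  "continuous_map (orbit_closure_space \<phi>) (orbit_closure_space \<phi>) (fun_act g)"
proof -
  have "continuous_map (orbit_closure_space \<phi>) pointed_functions (fun_act g)"
    unfolding orbit_closure_space_def
    by (intro continuous_map_from_subtopology continuous_map_fun_act_pointed)
  then show ?thesis
    using fun_act_orbit_closure_space[of _ \<phi> g]
    by (subst (2) orbit_closure_space_def)
       (auto simp: continuous_map_in_subtopology topspace_orbit_closure_space)
qed

lemma second_countable_orbit_closure_space: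
  "second_countable (orbit_closure_space (\<phi> :: 'g::{group_add,countable} \<Rightarrow> real))"
  unfolding orbit_closure_space_def pointed_functions_def
  by (intro second_countable_subtopology second_countable_euclidean)

text \<open>
  A quasimorphism with defect at most \<open>D\<close> has its orbit in the compact box
  \<open>\<Prod>\<^sub>h [- (\<bar>\<phi> h\<bar> + D), \<bar>\<phi> h\<bar> + D]\<close>.
\<close>

lemma compact_space_orbit_closure_space:
  assumes "quasimorphism \<phi>"
  shows "compact_space (orbit_closure_space \<phi>)"
proof -
  obtain D where D: "\<And>g h. \<bar>\<phi> (g + h) - \<phi> g - \<phi> h\<bar> \<le> D"
    using assms unfolding quasimorphism_def bdd_above_def by fastforce
  define box where "box = PiE UNIV (\<lambda>h. {- (\<bar>\<phi> h\<bar> + D)..\<bar>\<phi> h\<bar> + D})"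
  have "compactin (product_topology (\<lambda>_. euclideanreal) UNIV) box"
    unfolding box_def by (subst compactin_PiE) simp
  then have box: "compact box" by (simp add: euclidean_product_topology)
  have "fun_act g \<phi> h \<in> {- (\<bar>\<phi> h\<bar> + D)..\<bar>\<phi> h\<bar> + D}" for g h
    using D[of h g] by (simp add: fun_act_def abs_le_iff) linarith
  then have "range (\<lambda>g. fun_act g \<phi>) \<subseteq> box" by (auto simp: box_def)
  then have cl: "closure (range (\<lambda>g. fun_act g \<phi>)) \<subseteq> box"
  proof (rule closure_minimal)
    have "box = (\<Inter>h. {\<psi>. - (\<bar>\<phi> h\<bar> + D) \<le> \<psi> h} \<inter> {\<psi>. \<psi> h \<le> \<bar>\<phi> h\<bar> + D})"
      by (auto simp: box_def PiE_def Pi_def)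
    then show "closed box"
      by (auto intro!: closed_INT closed_Int closed_Collect_le continuous_on_product_coordinates)
  qed
  let ?Z = "{\<phi>::'a \<Rightarrow> real. \<phi> 0 = 0}"
  have Z: "closed ?Z"
    by (intro closed_Collect_eq continuous_on_product_coordinates continuous_on_const)
  have "range (\<lambda>g. fun_act g \<phi>) \<subseteq> ?Z" by (auto simp: fun_act_def)
  then have "pointed_functions closure_of range (\<lambda>g. fun_act g \<phi>)
      = ?Z \<inter> closure (range (\<lambda>g. fun_act g \<phi>))"
    unfolding pointed_functions_def
    by (subst closure_of_subtopology) (simp_all add: Int_absorb1)
  moreover have "compact (box \<inter> (?Z \<inter> closure (range (\<lambda>g. fun_act g \<phi>))))"
    by (intro compact_Int_closed box closed_Int Z closed_closure)
  moreover have "box \<inter> (?Z \<inter> closure (range (\<lambda>g. fun_act g \<phi>))) = ?Z \<inter> closure (range (\<lambda>g. fun_act g \<phi>))"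
    using cl by auto
  ultimately have "compact (pointed_functions closure_of range (\<lambda>g. fun_act g \<phi>))"
    by simp
  then show ?thesis
    unfolding orbit_closure_space_def
    by (intro compact_space_subtopology)
       (auto simp: pointed_functions_def compactin_subtopology dest: closure_of_subset_topspace[THEN subsetD])
qed

section \<open>The hull of a twisted set as a skew product\<close>

text \<open>
  The map \<open>(\<phi>, Q) \<mapsto> {(\<gamma>, t). \<phi> \<gamma> + t \<in> Q}\<close>; the twist of \<open>P\<close> by \<open>\<phi>\<close> is the image of \<open>(\<phi>, P)\<close>. Its slice
  over \<open>\<gamma>\<close> is the translate \<open>Q - \<phi> \<gamma>\<close>.
\<close>

definition twist_map :: "('g \<Rightarrow> real) \<times> real set \<Rightarrow> ('g \<times> real) set" where
  "twist_map = (\<lambda>(\<phi>, Q). {(g, t). \<phi> g + t \<in> Q})"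

lemma mem_set_act_iff: "x \<in> set_act t F \<longleftrightarrow> x + t \<in> F"
  by (auto simp: set_act_def image_iff) (metis add_diff_cancel)

lemma mem_twist_map_iff: "(\<gamma>, t) \<in> twist_map z \<longleftrightarrow> t \<in> set_act (fst z \<gamma>) (snd z)"
  by (simp add: twist_map_def case_prod_unfold mem_set_act_iff add.commute)

lemma twist_map_equivariant:
  "twist_map (skew_act fun_act set_act (\<lambda>g \<phi>. \<phi> g) g z) = set_act g (twist_map z)"
proof (cases g, cases z)
  fix \<gamma> t \<phi> Q assume "g = (\<gamma>, t)" "z = (\<phi>, Q)"
  then show ?thesis
    by (auto simp: twist_map_def skew_act_def mem_set_act_iff fun_act_def algebra_simps)
qed

lemma closed_twist_map:
  fixes z :: "('g::discrete_topology \<Rightarrow> real) \<times> real set"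
  assumes "closed (snd z)"
  shows "closed (twist_map z)"
proof -
  have "continuous_on UNIV (\<lambda>x::'g \<times> real. fst z (fst x))"
    by (rule continuous_on_compose2[of UNIV "fst z" UNIV fst])
       (auto intro: Topological_Spaces.continuous_on_discrete continuous_on_fst continuous_on_id)
  then have "closed ((\<lambda>x. fst z (fst x) + snd x) -` snd z)"
    by (intro closed_vimage assms continuous_intros)
  moreover have "(\<lambda>x. fst z (fst x) + snd x) -` snd z = twist_map z"
    by (auto simp: twist_map_def case_prod_unfold)
  ultimately show ?thesis by simp
qed

lemma finite_fst_compact:
  fixes K :: "('g::discrete_topology \<times> real) set"
  assumes "compact K"
  shows "finite (fst ` K)"
proof -
  have "compact (fst ` K)" by (intro compact_continuous_image continuous_on_fst continuous_on_id assms)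
  then obtain C where "C \<subseteq> fst ` K" "finite C" "fst ` K \<subseteq> (\<Union>c\<in>C. {c})"
    using compactE_image[of "fst ` K" "fst ` K" "\<lambda>c. {c}"] discrete_topology_class.open_discrete
    by auto
  then show ?thesis by (auto intro: finite_subset)
qed

text \<open>
  A compact subset of \<open>\<Gamma> \<times> \<real>\<close> lives over finitely many \<open>\<gamma>\<close>, so missing it is a finite conjunction of
  open conditions on the slices, each of which depends continuously on \<open>(\<phi>, Q)\<close>.
\<close>

lemma continuous_map_twist_map:
  "continuous_map (prod_topology pointed_functions chabauty_fell)
     (chabauty_fell :: ('g::{group_add,discrete_topology} \<times> real) set topology) twist_map"
    (is "continuous_map ?X _ _")
proof (subst chabauty_fell_def[where 'a="'g \<times> real"], rule continuous_on_generated_topo)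
  have slice: "continuous_map ?X chabauty_fell (\<lambda>z. set_act (fst z \<gamma>) (snd z))" for \<gamma>
  proof -
    have "continuous_map ?X euclideanreal ((\<lambda>\<phi>. \<phi> \<gamma>) \<circ> fst)"
      by (intro continuous_map_compose[OF continuous_map_fst] continuous_map_eval_pointed)
    then have "continuous_map ?X (prod_topology euclideanreal chabauty_fell) (\<lambda>z. (fst z \<gamma>, snd z))"
      by (intro continuous_map_pairedI continuous_map_snd) (simp add: comp_def)
    from continuous_map_compose[OF this continuous_map_set_act] show ?thesis
      by (simp add: comp_def)
  qed
  have closed_slice: "closed (set_act (fst z \<gamma>) (snd z))" if "z \<in> topspace ?X" for z \<gamma>
    using that by (auto intro: closed_set_act)
  have closed_tw: "closed (twist_map z)" if "z \<in> topspace ?X" for z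
    using that by (intro closed_twist_map) auto
  have missK: "openin ?X {z \<in> topspace ?X. twist_map z \<inter> K = {}}" if K: "compact K" for K
  proof -
    define Kg where "Kg = (\<lambda>\<gamma>. snd ` (K \<inter> {\<gamma>} \<times> UNIV))"
    have "compact (Kg \<gamma>)" for \<gamma>
      unfolding Kg_def
      by (intro compact_continuous_image continuous_on_snd continuous_on_id compact_Int_closed K closed_Times)
         auto
    then have "openin ?X {z \<in> topspace ?X. set_act (fst z \<gamma>) (snd z) \<in> {F. closed F \<and> F \<inter> Kg \<gamma> = {}}}" for \<gamma>
      by (intro openin_continuous_map_preimage[OF slice] openin_miss)
    then have "openin ?X (topspace ?X \<inter> (\<Inter>\<gamma>\<in>fst ` K.
        {z \<in> topspace ?X. set_act (fst z \<gamma>) (snd z) \<in> {F. closed F \<and> F \<inter> Kg \<gamma> = {}}}))"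
      using finite_fst_compact[OF K] openin_topspace[of ?X]
      by (intro openin_Int_Inter) (auto simp del: topspace_prod_topology)
    moreover have "topspace ?X \<inter> (\<Inter>\<gamma>\<in>fst ` K.
        {z \<in> topspace ?X. set_act (fst z \<gamma>) (snd z) \<in> {F. closed F \<and> F \<inter> Kg \<gamma> = {}}})
        = {z \<in> topspace ?X. twist_map z \<inter> K = {}}" (is "?A = ?B")
    proof (intro equalityI subsetI)
      fix z assume z: "z \<in> ?A"
      have "x \<notin> twist_map z" if "x \<in> K" for x
      proof -
        obtain \<gamma> t where x: "x = (\<gamma>, t)" by fastforce
        have "\<gamma> \<in> fst ` K" using that x by force
        then have "set_act (fst z \<gamma>) (snd z) \<inter> Kg \<gamma> = {}" using z by auto
        moreover have "t \<in> Kg \<gamma>" unfolding Kg_def using that x by force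
        ultimately show ?thesis unfolding x mem_twist_map_iff by blast
      qed
      then show "z \<in> ?B" using z by auto
    next
      fix z assume z: "z \<in> ?B"
      have "t \<notin> set_act (fst z \<gamma>) (snd z)" if "t \<in> Kg \<gamma>" for t \<gamma>
      proof -
        have "(\<gamma>, t) \<in> K" using that by (auto simp: Kg_def)
        then show ?thesis using z unfolding mem_twist_map_iff[symmetric] by blast
      qed
      then show "z \<in> ?A" using z closed_slice[of z] by auto
    qed
    ultimately show ?thesis by simp
  qed
  have hitU: "openin ?X {z \<in> topspace ?X. twist_map z \<inter> U \<noteq> {}}" if U: "open U" for U
  proof -
    define Ug where "Ug = (\<lambda>\<gamma>. Pair \<gamma> -` U)"
    have "open (Ug \<gamma>)" for \<gamma>
      unfolding Ug_def by (intro open_vimage U continuous_intros)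
    then have "openin ?X {z \<in> topspace ?X. set_act (fst z \<gamma>) (snd z) \<in> {F. closed F \<and> F \<inter> Ug \<gamma> \<noteq> {}}}" for \<gamma>
      by (intro openin_continuous_map_preimage[OF slice] openin_hit)
    then have "openin ?X (\<Union>\<gamma>.
        {z \<in> topspace ?X. set_act (fst z \<gamma>) (snd z) \<in> {F. closed F \<and> F \<inter> Ug \<gamma> \<noteq> {}}})"
      by (intro openin_Union) auto
    moreover have "(\<Union>\<gamma>.
        {z \<in> topspace ?X. set_act (fst z \<gamma>) (snd z) \<in> {F. closed F \<and> F \<inter> Ug \<gamma> \<noteq> {}}})
        = {z \<in> topspace ?X. twist_map z \<inter> U \<noteq> {}}" (is "?A = ?B")
    proof (intro equalityI subsetI)
      fix z assume "z \<in> ?A"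
      then obtain \<gamma> t where z: "z \<in> topspace ?X" "t \<in> set_act (fst z \<gamma>) (snd z)" "t \<in> Ug \<gamma>" by blast
      then have "(\<gamma>, t) \<in> twist_map z \<inter> U" by (simp add: mem_twist_map_iff Ug_def)
      then show "z \<in> ?B" using z(1) by blast
    next
      fix z assume z: "z \<in> ?B"
      then obtain \<gamma> t where "(\<gamma>, t) \<in> twist_map z" "(\<gamma>, t) \<in> U" by auto
      then have "t \<in> set_act (fst z \<gamma>) (snd z) \<inter> Ug \<gamma>" by (simp add: mem_twist_map_iff Ug_def)
      then show "z \<in> ?A" using z closed_slice[of z \<gamma>] by blast
    qed
    ultimately show ?thesis by simp
  qed
  fix W :: "('g \<times> real) set set"
  assume "W \<in> {{F. closed F \<and> F \<inter> K = {}} |K. compact K} \<union> {{F. closed F \<and> F \<inter> U \<noteq> {}} |U. open U}"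
  then consider (miss) K where "compact K" "W = {F. closed F \<and> F \<inter> K = {}}"
    | (hit) U where "open U" "W = {F. closed F \<and> F \<inter> U \<noteq> {}}" by auto
  then show "openin ?X (twist_map -` W \<inter> topspace ?X)"
  proof cases
    case miss
    then have "twist_map -` W \<inter> topspace ?X = {z \<in> topspace ?X. twist_map z \<inter> K = {}}"
      using closed_tw by auto
    then show ?thesis using missK miss by simp
  next
    case hit
    then have "twist_map -` W \<inter> topspace ?X = {z \<in> topspace ?X. twist_map z \<inter> U \<noteq> {}}"
      using closed_tw by auto
    then show ?thesis using hitU hit by simp
  qed
next
  have "twist_map ` topspace ?X \<subseteq> topspace (chabauty_fell :: ('g \<times> real) set topology)"
    by (auto intro!: closed_twist_map)
  then show "twist_map ` topspace ?X \<subseteq> \<Union> ({{F::('g \<times> real) set. closed F \<and> F \<inter> K = {}} |K. compact K} \<union>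
      {{F. closed F \<and> F \<inter> U \<noteq> {}} |U. open U})"
    unfolding chabauty_fell_def[where 'a="'g \<times> real"] topology_generated_by_topspace .
qed

lemma Hausdorff_space_chabauty_fell_prod:
  "Hausdorff_space (chabauty_fell :: ('g::discrete_topology \<times> real) set topology)"
proof (rule Hausdorff_space_chabauty_fell)
  fix x :: "'g \<times> real" and U assume U: "open U" "x \<in> U"
  have "open (Pair (fst x) -` U)" by (intro open_vimage U continuous_intros)
  moreover have "snd x \<in> Pair (fst x) -` U" using U by simp
  ultimately obtain e where e: "e > 0" "cball (snd x) e \<subseteq> Pair (fst x) -` U"
    using open_contains_cball by blast
  show "\<exists>V K. open V \<and> compact K \<and> x \<in> V \<and> V \<subseteq> K \<and> K \<subseteq> U"
  proof (intro exI conjI)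
    show "open ({fst x} \<times> ball (snd x) e)"
      by (intro open_Times discrete_topology_class.open_discrete) simp
    show "compact ({fst x} \<times> cball (snd x) e)" by (intro compact_Times) simp_all
    show "{fst x} \<times> cball (snd x) e \<subseteq> U" using e(2) by auto
  qed (use e in \<open>auto simp: mem_Times_iff\<close>)
qed

text \<open>
  The skew product is compact, so it suffices to see that the map is a continuous bijection. It is
  injective because the slice over \<open>0\<close> recovers \<open>Q\<close>, and then the slice over \<open>\<gamma>\<close>, a translate of \<open>Q\<close>,
  recovers \<open>\<phi> \<gamma>\<close> by freeness. It is onto because \<open>\<Delta> \<times> \<Omega>\<close> is the orbit closure of \<open>(\<phi>, P)\<close>.
\<close>

lemma homeomorphic_map_twist_map:
  fixes \<phi> :: "'g::{group_add,discrete_topology} \<Rightarrow> real"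
  assumes qm: "quasimorphism \<phi>" and \<phi>0: "\<phi> 0 = 0" and P: "closed P"
    and free: "free_action set_act (hull_space P)"
  shows "homeomorphic_map (prod_topology (orbit_closure_space \<phi>) (hull_space P))
      (hull_space (twist P \<phi>)) twist_map"
proof (rule continuous_imp_homeomorphic_map)
  let ?X = "prod_topology (orbit_closure_space \<phi>) (hull_space P)"
  let ?X' = "prod_topology pointed_functions chabauty_fell"
  let ?H = "hull_space (twist P \<phi>)"
  let ?skew = "skew_act fun_act set_act (\<lambda>g \<phi>. \<phi> g)"
  let ?O = "range (\<lambda>g. fun_act g \<phi>) \<times> range (\<lambda>t. set_act t P)"
  have X: "?X = subtopology ?X' ((pointed_functions closure_of range (\<lambda>g. fun_act g \<phi>)) \<times>
      (chabauty_fell closure_of range (\<lambda>t. set_act t P)))"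
    unfolding orbit_closure_space_def hull_space_def by (rule subtopology_Times[symmetric])
  have tX: "topspace ?X = ?X' closure_of ?O"
    unfolding topspace_prod_topology topspace_orbit_closure_space topspace_hull_space closure_of_Times ..
  have tw: "twist P \<phi> = twist_map (\<phi>, P)" by (simp add: twist_def twist_map_def)
  have "twist_map ` ?O \<subseteq> range (\<lambda>g. set_act g (twist P \<phi>))"
  proof clarify
    fix g t
    have "(fun_act g \<phi>, set_act t P) = ?skew (g, t - \<phi> g) (\<phi>, P)"
      by (simp add: skew_act_def)
    then show "twist_map (fun_act g \<phi>, set_act t P) \<in> range (\<lambda>g. set_act g (twist P \<phi>))"
      by (simp add: twist_map_equivariant tw)
  qed
  then have "chabauty_fell closure_of (twist_map ` ?O) \<subseteq> topspace ?H"
    unfolding topspace_hull_space by (rule closure_of_mono)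
  then have img: "twist_map ` topspace ?X \<subseteq> topspace ?H"
    unfolding tX by (rule subset_trans[OF continuous_map_image_closure_subset[OF continuous_map_twist_map]])
  have "continuous_map ?X chabauty_fell twist_map"
    by (subst X) (intro continuous_map_from_subtopology continuous_map_twist_map)
  then show cont: "continuous_map ?X ?H twist_map"
    using img unfolding topspace_hull_space
    by (subst hull_space_def[of "twist P \<phi>"]) (auto simp: continuous_map_in_subtopology)
  show comp: "compact_space ?X"
    by (simp add: compact_space_prod_topology compact_space_orbit_closure_space[OF qm]
        compact_space_hull_space)
  show haus: "Hausdorff_space ?H"
    unfolding hull_space_def by (intro Hausdorff_space_subtopology Hausdorff_space_chabauty_fell_prod)
  have "compactin chabauty_fell (twist_map ` topspace ?X)"
    using \<open>continuous_map ?X chabauty_fell twist_map\<close> comp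
    by (intro image_compactin) (auto simp: compact_space_def)
  then have "closedin chabauty_fell (twist_map ` topspace ?X)"
    by (rule compactin_imp_closedin[OF Hausdorff_space_chabauty_fell_prod])
  moreover have "range (\<lambda>g. set_act g (twist P \<phi>)) \<subseteq> twist_map ` topspace ?X"
  proof clarify
    fix \<gamma> :: 'g and t :: real
    have "fun_act \<gamma> \<phi> \<in> topspace (orbit_closure_space \<phi>)"
      unfolding topspace_orbit_closure_space
      by (rule subsetD[OF closure_of_subset]) (auto simp: fun_act_def)
    moreover have "set_act s P \<in> topspace (hull_space P)" for s
      unfolding topspace_hull_space
      by (rule subsetD[OF closure_of_subset]) (auto simp: P closed_set_act)
    ultimately have "?skew (\<gamma>, t) (\<phi>, P) \<in> topspace ?X"
      by (simp add: skew_act_def)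
    then show "set_act (\<gamma>, t) (twist P \<phi>) \<in> twist_map ` topspace ?X"
      unfolding tw twist_map_equivariant[symmetric] by (rule imageI)
  qed
  ultimately have "topspace ?H \<subseteq> twist_map ` topspace ?X"
    unfolding topspace_hull_space by (intro closure_of_minimal)
  then show "twist_map ` topspace ?X = topspace ?H" using img by (rule subset_antisym[rotated])
  show "inj_on twist_map (topspace ?X)"
  proof (rule inj_onI)
    fix z z' assume z: "z \<in> topspace ?X" "z' \<in> topspace ?X" and eq: "twist_map z = twist_map z'"
    have slice: "set_act (fst z \<gamma>) (snd z) = set_act (fst z' \<gamma>) (snd z')" for \<gamma>
    proof (rule set_eqI)
      fix t show "t \<in> set_act (fst z \<gamma>) (snd z) \<longleftrightarrow> t \<in> set_act (fst z' \<gamma>) (snd z')"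
        unfolding mem_twist_map_iff[symmetric] eq ..
    qed
    have 0: "fst z 0 = 0" "fst z' 0 = 0" and Q: "snd z \<in> topspace (hull_space P)"
      using z by (auto intro: pointed_of_orbit_closure_space)
    have snd: "snd z = snd z'" using slice[of 0] by (simp add: 0)
    have "fst z \<gamma> = fst z' \<gamma>" for \<gamma>
    proof -
      have "set_act (- fst z' \<gamma>) (set_act (fst z \<gamma>) (snd z)) = snd z"
        unfolding slice by (simp add: set_act_add snd)
      then have "set_act (- fst z' \<gamma> + fst z \<gamma>) (snd z) = snd z" by (simp add: set_act_add)
      then have "- fst z' \<gamma> + fst z \<gamma> = 0" using free Q unfolding free_action_def by blast
      then show ?thesis by simp
    qed
    then show "z = z'" using snd by (simp add: prod_eq_iff fun_eq_iff)
  qed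
qed


section \<open>Stationary measures\<close>

text \<open>
  Countability of \<open>\<Gamma>\<close> makes every open subset of \<open>\<Gamma> \<times> \<real>\<close> a countable union of products \<open>{\<gamma>} \<times> U\<close>.
\<close>

lemma sets_borel_countable_prod:
  "sets (borel :: ('g::{countable,discrete_topology} \<times> real) measure)
    = sets (count_space UNIV \<Otimes>\<^sub>M borel)"
proof
  have "S \<in> sets (count_space UNIV \<Otimes>\<^sub>M borel)" if "open S" for S :: "('g \<times> real) set"
  proof -
    have "open (Pair \<gamma> -` S)" for \<gamma> by (intro open_vimage \<open>open S\<close> continuous_intros)
    then have "(\<Union>\<gamma>. {\<gamma>} \<times> (Pair \<gamma> -` S)) \<in> sets (count_space UNIV \<Otimes>\<^sub>M borel)"
      by (intro sets.countable_UN'' pair_measureI) auto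
    moreover have "(\<Union>\<gamma>. {\<gamma>} \<times> (Pair \<gamma> -` S)) = S" by auto
    ultimately show ?thesis by simp
  qed
  then show "sets (borel :: ('g \<times> real) measure) \<subseteq> sets (count_space UNIV \<Otimes>\<^sub>M borel)"
    unfolding borel_of_euclidean[symmetric]
    by (intro borel_of_subset_sets) (simp_all add: space_pair_measure)
next
  have "fst \<in> (borel :: ('g \<times> real) measure) \<rightarrow>\<^sub>M count_space UNIV"
  proof (rule measurableI)
    fix A :: "'g set"
    have "open (fst -` A :: ('g \<times> real) set)"
      by (intro open_vimage discrete_topology_class.open_discrete continuous_on_fst continuous_on_id)
    then show "fst -` A \<inter> space (borel :: ('g \<times> real) measure) \<in> sets borel" by simp
  qed simp
  moreover have "snd \<in> (borel :: ('g \<times> real) measure) \<rightarrow>\<^sub>M borel"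
    by (intro borel_measurable_continuous_onI continuous_on_snd continuous_on_id)
  ultimately have id: "(\<lambda>x. x) \<in> (borel :: ('g \<times> real) measure) \<rightarrow>\<^sub>M count_space UNIV \<Otimes>\<^sub>M borel"
    by (intro measurable_pair) (simp_all add: comp_def)
  show "sets (count_space UNIV \<Otimes>\<^sub>M borel) \<subseteq> sets (borel :: ('g \<times> real) measure)"
  proof
    fix A :: "('g \<times> real) set" assume "A \<in> sets (count_space UNIV \<Otimes>\<^sub>M borel)"
    from measurable_sets[OF id this] show "A \<in> sets borel" by simp
  qed
qed

lemma measurable_fun_act:
  "(\<lambda>(g, \<psi>). fun_act g \<psi>) \<in> count_space UNIV \<Otimes>\<^sub>M borel_of (orbit_closure_space \<phi>)
    \<rightarrow>\<^sub>M borel_of (orbit_closure_space (\<phi> :: 'g::{group_add,countable} \<Rightarrow> real))"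
  by (intro measurable_pair_measure_countable1 countableI_type)
     (simp add: measurable_continuous_map[OF continuous_map_fun_act])

lemma measurable_set_act:
  "(\<lambda>(t, F). set_act t F) \<in> borel \<Otimes>\<^sub>M borel_of (hull_space P) \<rightarrow>\<^sub>M borel_of (hull_space (P :: real set))"
  using measurable_continuous_map[OF continuous_map_set_act_hull_space[of P]]
  by (simp add: measurable_cong_sets[OF sets_borel_of_prod refl] second_countable_euclidean
      second_countable_hull_space)

text \<open>The skew product space and its action, for the cocycle that evaluates a function at a group element.\<close>

abbreviation skew where
  "skew \<equiv> skew_act fun_act set_act (\<lambda>g \<phi>. \<phi> g)"

abbreviation skew_space where
  "skew_space \<phi> (P :: real set) \<equiv> prod_topology (orbit_closure_space \<phi>) (hull_space P)"

lemma skew_add: "skew (g + g') x = skew g (skew g' x)"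
  by (cases g, cases g', cases x)
     (simp add: skew_act_def fun_act_add set_act_add, simp add: fun_act_def algebra_simps)

lemma sets_borel_of_skew_space:
  "sets (borel_of (skew_space (\<phi> :: 'g::{group_add,countable} \<Rightarrow> real) P))
    = sets (borel_of (orbit_closure_space \<phi>) \<Otimes>\<^sub>M borel_of (hull_space P))"
  by (intro sets_borel_of_prod second_countable_orbit_closure_space second_countable_hull_space)

lemma measurable_skew:
  fixes \<phi> :: "'g::{group_add,countable,discrete_topology} \<Rightarrow> real"
  shows "(\<lambda>(g, x). skew g x) \<in> borel \<Otimes>\<^sub>M borel_of (skew_space \<phi> P) \<rightarrow>\<^sub>M borel_of (skew_space \<phi> P)"
proof -
  let ?D = "borel_of (orbit_closure_space \<phi>)" and ?O = "borel_of (hull_space P)"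
  let ?M = "((count_space UNIV :: 'g measure) \<Otimes>\<^sub>M (borel :: real measure)) \<Otimes>\<^sub>M (?D \<Otimes>\<^sub>M ?O)"
  have [measurable]: "(\<lambda>(g, \<psi>). \<psi> g) \<in> count_space UNIV \<Otimes>\<^sub>M ?D \<rightarrow>\<^sub>M borel"
    using measurable_continuous_map[OF continuous_map_eval_orbit_closure_space[of \<phi>]]
    by (intro measurable_pair_measure_countable1 countableI_type) simp
  have "(\<lambda>z. (\<lambda>(g, \<psi>). \<psi> g) (fst (fst z), fst (snd z)) + snd (fst z)) \<in> ?M \<rightarrow>\<^sub>M borel"
    by measurable
  then have 2: "(\<lambda>z. (\<lambda>(t, F). set_act t F)
      ((\<lambda>(g, \<psi>). \<psi> g) (fst (fst z), fst (snd z)) + snd (fst z), snd (snd z))) \<in> ?M \<rightarrow>\<^sub>M ?O"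
    by (intro measurable_compose[OF _ measurable_set_act] measurable_Pair) simp_all
  have 1: "(\<lambda>z. (\<lambda>(g, \<psi>). fun_act g \<psi>) (fst (fst z), fst (snd z))) \<in> ?M \<rightarrow>\<^sub>M ?D"
    by (intro measurable_compose[OF _ measurable_fun_act] measurable_Pair) simp_all
  have "(\<lambda>(g, x). skew g x) \<in> ?M \<rightarrow>\<^sub>M ?D \<Otimes>\<^sub>M ?O"
    using measurable_Pair[OF 1 2] by (simp add: skew_act_def case_prod_unfold)
  moreover have "sets (borel \<Otimes>\<^sub>M borel_of (skew_space \<phi> P)) = sets ?M"
    by (intro sets_pair_measure_cong sets_borel_countable_prod sets_borel_of_skew_space)
  ultimately show ?thesis
    by (simp add: measurable_cong_sets[OF _ sets_borel_of_skew_space])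
qed

text \<open>Equivariant images of stationary measures are stationary.\<close>

lemma distr_stationary:
  assumes p: "prob_space p" and \<eta>: "\<eta> \<in> stationary_probs p act X"
    and f: "f \<in> borel_of X \<rightarrow>\<^sub>M borel_of Y"
    and act: "(\<lambda>(g, x). act g x) \<in> p \<Otimes>\<^sub>M borel_of X \<rightarrow>\<^sub>M borel_of X"
    and act': "(\<lambda>(g, y). act' g y) \<in> p \<Otimes>\<^sub>M borel_of Y \<rightarrow>\<^sub>M borel_of Y"
    and equi: "\<And>g x. x \<in> topspace X \<Longrightarrow> f (act g x) = act' g (f x)"
  shows "distr \<eta> (borel_of Y) f \<in> stationary_probs p act' Y"
proof -
  note \<eta>' = stationary_probsD[OF \<eta>]
  interpret p: prob_space p by (rule p)
  interpret \<eta>: prob_space \<eta> by (rule \<eta>')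
  have f_\<eta>: "f \<in> \<eta> \<rightarrow>\<^sub>M borel_of Y" using f by (simp add: measurable_cong_sets[OF \<eta>'(2) refl])
  interpret \<eta>f: prob_space "distr \<eta> (borel_of Y) f" by (rule \<eta>.prob_space_distr[OF f_\<eta>])
  have act_\<eta>: "(\<lambda>(g, x). act g x) \<in> p \<Otimes>\<^sub>M \<eta> \<rightarrow>\<^sub>M borel_of X"
    using act by (simp add: measurable_cong_sets[OF sets_pair_measure_cong[OF refl \<eta>'(2)] refl])
  have "p \<Otimes>\<^sub>M distr \<eta> (borel_of Y) f = distr p p (\<lambda>g. g) \<Otimes>\<^sub>M distr \<eta> (borel_of Y) f"
    by (simp add: distr_id2)
  also have "\<dots> = distr (p \<Otimes>\<^sub>M \<eta>) (p \<Otimes>\<^sub>M borel_of Y) (\<lambda>(g, x). (g, f x))"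
    by (intro pair_measure_distr f_\<eta> \<eta>f.sigma_finite_measure_axioms) simp
  finally have "distr (p \<Otimes>\<^sub>M distr \<eta> (borel_of Y) f) (borel_of Y) (\<lambda>(g, y). act' g y)
      = distr (p \<Otimes>\<^sub>M \<eta>) (borel_of Y) ((\<lambda>(g, y). act' g y) \<circ> (\<lambda>(g, x). (g, f x)))"
    using f_\<eta> by (simp add: distr_distr[OF act'])
  also have "\<dots> = distr (p \<Otimes>\<^sub>M \<eta>) (borel_of Y) (f \<circ> (\<lambda>(g, x). act g x))"
    by (rule distr_cong) (auto simp: space_pair_measure \<eta>'(3) equi)
  also have "\<dots> = distr \<eta> (borel_of Y) f"
    by (subst (2) \<eta>'(4)[symmetric]) (rule distr_distr[OF f act_\<eta>, symmetric])
  finally show ?thesis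
    using \<eta>f.prob_space_axioms by (simp add: stationary_probs_def borel_probs_def)
qed

lemma distr_distr_inverse:
  assumes "sets \<eta> = sets (borel_of X)" "u \<in> borel_of X \<rightarrow>\<^sub>M borel_of Y" "v \<in> borel_of Y \<rightarrow>\<^sub>M borel_of X"
    and "\<And>x. x \<in> topspace X \<Longrightarrow> v (u x) = x"
  shows "distr (distr \<eta> (borel_of Y) u) (borel_of X) v = \<eta>"
proof -
  have sp: "space \<eta> = topspace X" using sets_eq_imp_space_eq[OF assms(1)] by simp
  have "u \<in> \<eta> \<rightarrow>\<^sub>M borel_of Y" using assms(2) by (simp add: measurable_cong_sets[OF assms(1) refl])
  then have "distr (distr \<eta> (borel_of Y) u) (borel_of X) v = distr \<eta> (borel_of X) (v \<circ> u)"
    by (rule distr_distr[OF assms(3)])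
  also have "\<dots> = distr \<eta> \<eta> (\<lambda>x. x)"
    by (rule distr_cong) (simp_all add: assms sp)
  finally show ?thesis by (simp add: distr_id2)
qed

lemma distr_stationary_homeomorphic:
  assumes p: "prob_space p"
    and hom: "homeomorphic_map X Y f"
    and act: "(\<lambda>(g, x). act g x) \<in> p \<Otimes>\<^sub>M borel_of X \<rightarrow>\<^sub>M borel_of X"
    and equi: "\<And>g x. x \<in> topspace X \<Longrightarrow> f (act g x) = act' g (f x)"
    and act_top: "\<And>g x. x \<in> topspace X \<Longrightarrow> act g x \<in> topspace X"
  shows "bij_betw (\<lambda>\<eta>. distr \<eta> (borel_of Y) f) (stationary_probs p act X) (stationary_probs p act' Y)"
proof -
  obtain k where k: "continuous_map X Y f" "continuous_map Y X k"
      "\<And>x. x \<in> topspace X \<Longrightarrow> k (f x) = x" "\<And>y. y \<in> topspace Y \<Longrightarrow> f (k y) = y"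
    using hom unfolding homeomorphic_map_maps homeomorphic_maps_def by blast
  note f = measurable_continuous_map[OF k(1)] and k' = measurable_continuous_map[OF k(2)]
  have k_top: "k y \<in> topspace X" if "y \<in> topspace Y" for y
    using k(2) that by (auto simp: continuous_map_def)
  have act'_eq: "act' g y = f (act g (k y))" if "y \<in> topspace Y" for g y
    using equi[OF k_top[OF that]] k(4)[OF that] by simp
  have "(\<lambda>(g, y). f (act g (k y))) \<in> p \<Otimes>\<^sub>M borel_of Y \<rightarrow>\<^sub>M borel_of Y"
  proof -
    have "(\<lambda>z. (fst z, k (snd z))) \<in> p \<Otimes>\<^sub>M borel_of Y \<rightarrow>\<^sub>M p \<Otimes>\<^sub>M borel_of X"
      using k' by simp
    from measurable_compose[OF measurable_compose[OF this act] f] show ?thesis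
      by (simp add: case_prod_unfold)
  qed
  then have act': "(\<lambda>(g, y). act' g y) \<in> p \<Otimes>\<^sub>M borel_of Y \<rightarrow>\<^sub>M borel_of Y"
    by (subst measurable_cong[where g = "\<lambda>(g, y). f (act g (k y))"])
       (auto simp: space_pair_measure act'_eq)
  show ?thesis
  proof (rule bij_betwI[where g = "\<lambda>\<eta>. distr \<eta> (borel_of X) k"])
    show "(\<lambda>\<eta>. distr \<eta> (borel_of Y) f) \<in> stationary_probs p act X \<rightarrow> stationary_probs p act' Y"
      by (intro funcsetI distr_stationary[where act = act and act' = act' and f = f, OF p _ f act act'] equi)
    show "(\<lambda>\<eta>. distr \<eta> (borel_of X) k) \<in> stationary_probs p act' Y \<rightarrow> stationary_probs p act X"
    proof (intro funcsetI distr_stationary[where act = act' and act' = act and f = k, OF p _ k' act' act])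
      show "k (act' g y) = act g (k y)" if "y \<in> topspace Y" for g y
        unfolding act'_eq[OF that] by (rule k(3)[OF act_top[OF k_top[OF that]]])
    qed
    show "distr (distr \<eta> (borel_of Y) f) (borel_of X) k = \<eta>" if "\<eta> \<in> stationary_probs p act X" for \<eta>
      by (rule distr_distr_inverse[OF stationary_probsD(2)[OF that] f k' k(3)])
    show "distr (distr \<eta> (borel_of X) k) (borel_of Y) f = \<eta>" if "\<eta> \<in> stationary_probs p act' Y" for \<eta>
      by (rule distr_distr_inverse[OF stationary_probsD(2)[OF that] k' f k(4)])
  qed
qed

text \<open>
  Stationarity for the projection of \<open>p\<close> to \<open>\<Gamma>\<close> is stationarity for \<open>p\<close> when \<open>\<Gamma> \<times> \<real>\<close> acts through \<open>\<Gamma>\<close>.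
  This makes the projection of the skew product to its base equivariant.
\<close>

lemma stationary_probs_push_fst:
  fixes p :: "('g::discrete_topology \<times> real) measure"
  assumes p: "prob_space p" "sets p = sets borel"
    and act: "(\<lambda>(g, x). act g x) \<in> borel \<Otimes>\<^sub>M borel_of X \<rightarrow>\<^sub>M borel_of X"
  shows "stationary_probs (push_fst p) act X = stationary_probs p (\<lambda>g. act (fst g)) X"
proof -
  interpret p: prob_space p by (rule p)
  have fst: "fst \<in> p \<rightarrow>\<^sub>M borel"
    unfolding measurable_cong_sets[OF p(2) refl]
    by (intro borel_measurable_continuous_onI continuous_on_fst continuous_on_id)
  have "distr (push_fst p \<Otimes>\<^sub>M \<nu>) (borel_of X) (\<lambda>(g, x). act g x)
      = distr (p \<Otimes>\<^sub>M \<nu>) (borel_of X) (\<lambda>(g, x). act (fst g) x)"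
    if \<nu>: "\<nu> \<in> borel_probs X" for \<nu>
  proof -
    interpret \<nu>: prob_space \<nu> using \<nu> by (simp add: borel_probs_def)
    have s: "sets \<nu> = sets (borel_of X)" using \<nu> by (simp add: borel_probs_def)
    have act': "(\<lambda>(g, x). act g x) \<in> borel \<Otimes>\<^sub>M \<nu> \<rightarrow>\<^sub>M borel_of X"
      using act by (simp add: measurable_cong_sets[OF sets_pair_measure_cong[OF refl s] refl])
    have id: "distr \<nu> \<nu> (\<lambda>x. x) = \<nu>" by (rule distr_id2) simp
    have "push_fst p \<Otimes>\<^sub>M \<nu> = distr (p \<Otimes>\<^sub>M \<nu>) (borel \<Otimes>\<^sub>M \<nu>) (\<lambda>(g, x). (fst g, x))"
      using pair_measure_distr[OF fst measurable_ident, of \<nu>] \<nu>.sigma_finite_measure_axioms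
      by (simp add: push_fst_def id id_def)
    moreover have "(\<lambda>(g, x). (fst g, x)) \<in> p \<Otimes>\<^sub>M \<nu> \<rightarrow>\<^sub>M borel \<Otimes>\<^sub>M \<nu>"
    proof -
      note fst[measurable]
      show ?thesis by measurable
    qed
    ultimately show ?thesis
      using distr_distr[OF act', of "\<lambda>(g, x). (fst g, x)" "p \<Otimes>\<^sub>M \<nu>"]
      by (simp add: comp_def case_prod_unfold)
  qed
  then show ?thesis unfolding stationary_probs_def by auto
qed

text \<open>
  For fixed \<open>g\<close> and \<open>\<psi>\<close> the group element \<open>g\<close> acts on the fibre over \<open>\<psi>\<close> by a translation, which
  preserves \<open>\<theta>\<close>; integrating out the fibre leaves the stationarity of \<open>\<nu>\<close>.
\<close>

lemma stationary_pair_measure: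
  fixes p :: "('g::{group_add,countable,discrete_topology} \<times> real) measure"
  assumes p: "prob_space p" "sets p = sets borel"
    and \<nu>: "\<nu> \<in> stationary_probs p (\<lambda>g. fun_act (fst g)) (orbit_closure_space \<phi>)"
    and \<theta>: "\<theta> \<in> invariant_probs set_act (hull_space P)"
  shows "\<nu> \<Otimes>\<^sub>M \<theta> \<in> stationary_probs p skew (skew_space \<phi> P)"
proof -
  let ?D = "borel_of (orbit_closure_space \<phi>)" and ?O = "borel_of (hull_space P)"
  let ?X = "skew_space \<phi> P"
  note \<nu>' = stationary_probsD[OF \<nu>]
  have \<theta>': "prob_space \<theta>" "sets \<theta> = sets ?O" "\<And>t. distr \<theta> ?O (set_act t) = \<theta>"
    using \<theta> by (auto simp: invariant_probs_def borel_probs_def)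
  interpret p: prob_space p by (rule p)
  interpret \<nu>: prob_space \<nu> by (rule \<nu>')
  interpret \<theta>: prob_space \<theta> by (rule \<theta>')
  interpret \<nu>\<theta>: pair_prob_space \<nu> \<theta> ..
  have s: "sets (\<nu> \<Otimes>\<^sub>M \<theta>) = sets (borel_of ?X)"
    using sets_pair_measure_cong[OF \<nu>'(2) \<theta>'(2)] by (simp add: sets_borel_of_skew_space)
  have meas: "(\<lambda>(g, x). skew g x) \<in> p \<Otimes>\<^sub>M (\<nu> \<Otimes>\<^sub>M \<theta>) \<rightarrow>\<^sub>M borel_of ?X"
    using measurable_skew[of \<phi> P] by (simp add: measurable_cong_sets[OF sets_pair_measure_cong[OF p(2) s] refl])
  have "fst \<in> p \<rightarrow>\<^sub>M count_space UNIV"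
    unfolding measurable_cong_sets[OF trans[OF p(2) sets_borel_countable_prod] refl] by simp
  then have fmeas: "(\<lambda>z. (\<lambda>(g, \<psi>). fun_act g \<psi>) (fst (fst z), snd z)) \<in> p \<Otimes>\<^sub>M ?D \<rightarrow>\<^sub>M ?D"
    by (intro measurable_compose[OF _ measurable_fun_act] measurable_Pair) simp_all
  then have fmeas: "(\<lambda>(g, \<psi>). fun_act (fst g) \<psi>) \<in> p \<Otimes>\<^sub>M \<nu> \<rightarrow>\<^sub>M ?D"
    by (simp add: measurable_cong_sets[OF sets_pair_measure_cong[OF refl \<nu>'(2)] refl] case_prod_unfold)
  have set_act: "set_act t \<in> \<theta> \<rightarrow>\<^sub>M ?O" for t
    using measurable_Pair2[OF measurable_set_act, of t P] by (simp add: measurable_cong_sets[OF \<theta>'(2) refl])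
  have "\<nu> \<Otimes>\<^sub>M \<theta> = distr (p \<Otimes>\<^sub>M (\<nu> \<Otimes>\<^sub>M \<theta>)) (borel_of ?X) (\<lambda>(g, x). skew g x)" (is "_ = ?R")
  proof (rule pair_measure_eqI)
    show "sigma_finite_measure \<nu>" "sigma_finite_measure \<theta>" by unfold_locales
    show "sets (\<nu> \<Otimes>\<^sub>M \<theta>) = sets ?R" using s by simp
    fix B A assume "B \<in> sets \<nu>" "A \<in> sets \<theta>"
    then have B: "B \<in> sets ?D" and A: "A \<in> sets ?O" using \<nu>' \<theta>' by simp_all
    let ?S = "(\<lambda>(g, x). skew g x) -` (B \<times> A) \<inter> space (p \<Otimes>\<^sub>M (\<nu> \<Otimes>\<^sub>M \<theta>))"
    let ?T = "(\<lambda>(g, \<psi>). fun_act (fst g) \<psi>) -` B \<inter> space (p \<Otimes>\<^sub>M \<nu>)"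
    have BA: "B \<times> A \<in> sets (borel_of ?X)" using A B by (simp add: sets_borel_of_skew_space)
    have S: "?S \<in> sets (p \<Otimes>\<^sub>M (\<nu> \<Otimes>\<^sub>M \<theta>))" by (rule measurable_sets[OF meas BA])
    have T: "?T \<in> sets (p \<Otimes>\<^sub>M \<nu>)" by (rule measurable_sets[OF fmeas B])
    have "emeasure ?R (B \<times> A) = emeasure (p \<Otimes>\<^sub>M (\<nu> \<Otimes>\<^sub>M \<theta>)) ?S"
      by (rule emeasure_distr[OF meas BA])
    also have "\<dots> = (\<integral>\<^sup>+g. emeasure (\<nu> \<Otimes>\<^sub>M \<theta>) (Pair g -` ?S) \<partial>p)"
      by (rule \<nu>\<theta>.P.emeasure_pair_measure_alt[OF S])
    also have "\<dots> = (\<integral>\<^sup>+g. emeasure \<nu> (Pair g -` ?T) * emeasure \<theta> A \<partial>p)"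
    proof (rule nn_integral_cong)
      fix g assume g: "g \<in> space p"
      have "emeasure (\<nu> \<Otimes>\<^sub>M \<theta>) (Pair g -` ?S) = (\<integral>\<^sup>+\<psi>. emeasure \<theta> (Pair \<psi> -` (Pair g -` ?S)) \<partial>\<nu>)"
        by (rule \<theta>.emeasure_pair_measure_alt[OF sets_Pair1[OF S]])
      also have "\<dots> = (\<integral>\<^sup>+\<psi>. emeasure \<theta> A * indicator (Pair g -` ?T) \<psi> \<partial>\<nu>)"
      proof (rule nn_integral_cong)
        fix \<psi> assume \<psi>: "\<psi> \<in> space \<nu>"
        have *: "Pair \<psi> -` (Pair g -` ?S) = (if fun_act (fst g) \<psi> \<in> B then
            set_act (\<psi> (fst g) + snd g) -` A \<inter> space \<theta> else {})"
          using g \<psi> by (auto simp: space_pair_measure skew_act_def case_prod_unfold)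
        have "emeasure \<theta> (set_act t -` A \<inter> space \<theta>) = emeasure \<theta> A" for t
          using emeasure_distr[OF set_act A, of t] \<theta>'(3)[of t] by simp
        then show "emeasure \<theta> (Pair \<psi> -` (Pair g -` ?S)) = emeasure \<theta> A * indicator (Pair g -` ?T) \<psi>"
          unfolding * using g \<psi> by (auto simp: space_pair_measure split: split_indicator)
      qed
      also have "\<dots> = emeasure \<nu> (Pair g -` ?T) * emeasure \<theta> A"
        using sets_Pair1[OF T] by (simp add: nn_integral_cmult mult.commute)
      finally show "emeasure (\<nu> \<Otimes>\<^sub>M \<theta>) (Pair g -` ?S) = emeasure \<nu> (Pair g -` ?T) * emeasure \<theta> A" .
    qed
    also have "\<dots> = emeasure (p \<Otimes>\<^sub>M \<nu>) ?T * emeasure \<theta> A"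
      using \<nu>.measurable_emeasure_Pair[OF T]
      by (simp add: nn_integral_multc \<nu>.emeasure_pair_measure_alt[OF T])
    also have "emeasure (p \<Otimes>\<^sub>M \<nu>) ?T = emeasure \<nu> B"
      using emeasure_distr[OF fmeas B] \<nu>'(4) by simp
    finally show "emeasure \<nu> B * emeasure \<theta> A = emeasure ?R (B \<times> A)" by simp
  qed
  then show ?thesis
    using s \<nu>\<theta>.P.prob_space_axioms by (simp add: stationary_probs_def borel_probs_def)
qed

text \<open>
  Lipschitz functions approximating the indicator of \<open>B \<times> {F. F \<inter> K = {}}\<close> have the same integral after
  a central translation. In the limit this is the invariance that makes \<open>\<eta>\<close> a product measure.
\<close>

lemma stationary_skew_product:
  fixes p :: "('g::{group_add,countable,discrete_topology} \<times> real) measure" and P :: "real set"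
  assumes p: "prob_space p" "sets p = sets borel"
    and gen: "semigroup_generated (measure_support p) = UNIV"
    and \<eta>: "\<eta> \<in> stationary_probs p skew (skew_space \<phi> P)"
    and ue: "uniquely_ergodic set_act (hull_space P)"
    and \<theta>: "\<theta> \<in> invariant_probs set_act (hull_space P)"
  shows "\<eta> = distr \<eta> (borel_of (orbit_closure_space \<phi>)) fst \<Otimes>\<^sub>M \<theta>"
proof (rule product_measure_of_fibrewise_invariant[OF _ _ _ ue \<theta>])
  let ?D = "borel_of (orbit_closure_space \<phi>)" and ?O = "borel_of (hull_space P)"
  let ?X = "skew_space \<phi> P"
  note \<eta>' = stationary_probsD[OF \<eta>]
  show "prob_space \<eta>" by (rule \<eta>')
  show s: "sets \<eta> = sets (?D \<Otimes>\<^sub>M ?O)" using \<eta>'(2) by (simp add: sets_borel_of_skew_space)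
  interpret \<eta>: prob_space \<eta> by (rule \<eta>')
  fix B and K :: "real set" and s :: real assume B: "B \<in> sets ?D" and K: "compact K"
  have skew_0: "skew (0, a) (\<psi>, F) = (\<psi>, set_act a F)" if "(\<psi>, F) \<in> topspace ?X" for \<psi> F a
    using that pointed_of_orbit_closure_space[of \<psi> \<phi>] by (simp add: skew_act_def fun_act_0)
  show "measure \<eta> (B \<times> {F \<in> topspace (hull_space P). set_act s F \<inter> K = {}})
      = measure \<eta> (B \<times> {F \<in> topspace (hull_space P). F \<inter> K = {}})"
  proof (cases "K = {}")
    case False
    \<comment> \<open>\<open>K = {}\<close> is treated apart because the distance to \<open>{}\<close> is \<open>0\<close> by convention\<close>
    define \<psi> where "\<psi> = (\<lambda>n x. real n * infdist x K)"
    have nonneg: "\<psi> n x \<ge> 0" for n x by (simp add: \<psi>_def infdist_nonneg)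
    have lip: "\<bar>\<psi> n x - \<psi> n y\<bar> \<le> real n * \<bar>x - y\<bar>" for n x y
    proof -
      have "\<bar>infdist x K - infdist y K\<bar> \<le> dist x y" by (rule infdist_triangle_abs)
      then show ?thesis
        by (simp add: \<psi>_def dist_real_def abs_mult mult_left_mono flip: right_diff_distrib)
    qed
    define f where "f = (\<lambda>n z. indicator B (fst z) * soft_miss (\<psi> n) (snd z))"
    have fm: "f n \<in> borel_measurable (?D \<Otimes>\<^sub>M ?O)" for n
    proof -
      have "continuous_on UNIV (\<psi> n)" unfolding \<psi>_def by (intro continuous_intros)
      then have [measurable]: "soft_miss (\<psi> n) \<in> borel_measurable ?O"
        by (intro borel_measurable_soft_miss nonneg)
      note B[measurable]
      show ?thesis unfolding f_def by measurable
    qed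
    then have fmX: "f n \<in> borel_measurable (borel_of ?X)" for n
      by (simp add: measurable_cong_sets[OF sets_borel_of_skew_space refl])
    have fb: "\<bar>f n z\<bar> \<le> 1" for n z
      using abs_soft_miss_le_1[of "\<psi> n" "snd z", OF nonneg] by (auto simp: f_def split: split_indicator)
    have inv: "(\<integral>z. f n (skew (0, a) z) \<partial>\<eta>) = (\<integral>z. f n z \<partial>\<eta>)" for n a
    proof (rule stationary_integral_central[OF p gen \<eta> measurable_skew _ skew_add fmX fb])
      show "skew 0 z = z" if "z \<in> topspace ?X" for z
        using that skew_0[of "fst z" "snd z" 0] by (simp add: zero_prod_def)
      show "\<bar>f n (skew (0, a) z) - f n z\<bar> \<le> real n * \<bar>a\<bar>" if "z \<in> topspace ?X" for z a
        using skew_0[of "fst z" "snd z" a] that soft_miss_Lipschitz[of "\<psi> n" "real n" a "snd z", OF nonneg lip]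
        by (auto simp: f_def split: split_indicator)
    qed simp
    have lim: "(\<lambda>n. \<integral>z. f n (skew (0, a) z) \<partial>\<eta>)
        \<longlonglongrightarrow> measure \<eta> (B \<times> {F \<in> topspace (hull_space P). set_act a F \<inter> K = {}})" for a
    proof -
      let ?E = "{F \<in> topspace (hull_space P). set_act a F \<inter> K = {}}"
      have "(\<lambda>x. x + a) ` K = (+) a ` K" by (simp add: add.commute)
      then have K': "compact ((\<lambda>x. x + a) ` K)" using compact_translation[OF K, of a] by simp
      have "?E = {F \<in> topspace (hull_space P). F \<in> {F. closed F \<and> F \<inter> (\<lambda>x. x + a) ` K = {}}}"
        by (auto simp: set_act_Int_eq_empty closed_of_hull_space)
      then have E: "?E \<in> sets ?O"
        using openin_borel_of[OF openin_hull_space[OF openin_miss[OF K'], of P]] by simp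
      have skm: "skew (0, a) \<in> borel_of ?X \<rightarrow>\<^sub>M borel_of ?X"
        using measurable_Pair2[OF measurable_skew[of \<phi> P], of "(0, a)"] by simp
      have "(\<lambda>n. \<integral>z. f n (skew (0, a) z) \<partial>\<eta>) \<longlonglongrightarrow> (\<integral>z. indicator (B \<times> ?E) z \<partial>\<eta>)"
      proof (rule integral_dominated_convergence[where w = "\<lambda>_. 1"])
        show "indicator (B \<times> ?E) \<in> borel_measurable \<eta>" using E B s by simp
        show "(\<lambda>z. f n (skew (0, a) z)) \<in> borel_measurable \<eta>" for n
          using measurable_compose[OF skm fmX] by (simp add: measurable_cong_sets[OF \<eta>'(2) refl])
        show "AE z in \<eta>. (\<lambda>n. f n (skew (0, a) z)) \<longlonglongrightarrow> indicator (B \<times> ?E) z"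
        proof (rule AE_I2)
          fix z assume "z \<in> space \<eta>"
          then have z: "z \<in> topspace ?X" using \<eta>'(3) by simp
          then have "closed (set_act a (snd z))"
            by (intro closed_set_act) (auto intro: closed_of_hull_space)
          from tendsto_mult[OF tendsto_const soft_miss_tendsto_indicator[OF this K False]]
          have "(\<lambda>n. indicator B (fst z) * soft_miss (\<psi> n) (set_act a (snd z))) \<longlonglongrightarrow>
              indicator B (fst z) * indicator {F. F \<inter> K = {}} (set_act a (snd z))"
            unfolding \<psi>_def .
          moreover have "indicator B (fst z) * indicator {F. F \<inter> K = {}} (set_act a (snd z))
              = (indicator (B \<times> ?E) z :: real)"
            using z by (auto split: split_indicator)
          ultimately show "(\<lambda>n. f n (skew (0, a) z)) \<longlonglongrightarrow> indicator (B \<times> ?E) z"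
            using skew_0[of "fst z" "snd z" a] z by (simp add: f_def)
        qed
        show "AE z in \<eta>. norm (f n (skew (0, a) z)) \<le> 1" for n
          using fb by simp
      qed simp
      moreover have "B \<times> ?E \<in> sets \<eta>" using E B s by simp
      ultimately show ?thesis by simp
    qed
    have "measure \<eta> (B \<times> {F \<in> topspace (hull_space P). set_act s F \<inter> K = {}})
      = measure \<eta> (B \<times> {F \<in> topspace (hull_space P). set_act 0 F \<inter> K = {}})"
      using lim[of s] lim[of 0] unfolding inv by (rule LIMSEQ_unique)
    then show ?thesis by simp
  qed simp
qed

theorem proposition1p10:
  fixes \<phi>\<^sub>o :: "'g::{group_add, countable, discrete_topology} \<Rightarrow> real"
    and p \<mu> :: "('g \<times> real) measure"
    and P :: "real set"
    and \<theta> :: "real set measure"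
    and c :: "'g \<Rightarrow> ('g \<Rightarrow> real) \<Rightarrow> real"
    and \<Phi> :: "('g \<Rightarrow> real) \<times> real set \<Rightarrow> ('g \<times> real) set"
  assumes "quasimorphism \<phi>\<^sub>o" and "\<phi>\<^sub>o 0 = 0"
    and "\<not> (\<exists>\<psi>. real_hom \<psi> \<and> at_bounded_distance \<phi>\<^sub>o \<psi>)"
    and "prob_space p" and "sets p = sets borel"
    and "symmetric_measure p"
    and "haar_measure \<mu>" and "absolutely_continuous \<mu> p"
    and "semigroup_generated (measure_support p) = UNIV"
    and "p_integrable p \<phi>\<^sub>o"
    and "closed P"
    and "free_action set_act (hull_space P)"
    and "uniquely_ergodic set_act (hull_space P)"
    and "\<theta> \<in> invariant_probs set_act (hull_space P)"
  defines "c \<equiv> \<lambda>g \<phi>. \<phi> g"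
    and "\<Phi> \<equiv> \<lambda>(\<phi>, Q). {(g, t). \<phi> g + t \<in> Q}"
  shows "bij_betw (\<lambda>\<nu>. \<nu> \<Otimes>\<^sub>M \<theta>)
      (stationary_probs (push_fst p) fun_act (orbit_closure_space \<phi>\<^sub>o))
      (stationary_probs p (skew_act fun_act set_act c)
        (prod_topology (orbit_closure_space \<phi>\<^sub>o) (hull_space P)))
    \<and> homeomorphic_map (prod_topology (orbit_closure_space \<phi>\<^sub>o) (hull_space P))
        (hull_space (twist P \<phi>\<^sub>o)) \<Phi>
    \<and> (\<forall>x \<in> topspace (prod_topology (orbit_closure_space \<phi>\<^sub>o) (hull_space P)). \<forall>g.
        \<Phi> (skew_act fun_act set_act c g x) = set_act g (\<Phi> x))
    \<and> bij_betw (\<lambda>\<nu>. distr (\<nu> \<Otimes>\<^sub>M \<theta>) (borel_of (hull_space (twist P \<phi>\<^sub>o))) \<Phi>)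
      (stationary_probs (push_fst p) fun_act (orbit_closure_space \<phi>\<^sub>o))
      (stationary_probs p set_act (hull_space (twist P \<phi>\<^sub>o)))"
proof -
  let ?D = "orbit_closure_space \<phi>\<^sub>o" and ?X = "skew_space \<phi>\<^sub>o P"
  have \<Phi>: "\<Phi> = twist_map" by (simp add: \<Phi>_def twist_map_def)
  note p = assms(4,5) and gen = assms(9) and ue = assms(13) and \<theta> = assms(14)
  interpret p: prob_space p by (rule p)
  interpret \<theta>: prob_space \<theta> using \<theta> by (simp add: invariant_probs_def borel_probs_def)
  have push: "stationary_probs (push_fst p) fun_act ?D = stationary_probs p (\<lambda>g. fun_act (fst g)) ?D"
  proof (rule stationary_probs_push_fst[OF p])
    have s: "sets (borel :: 'g measure) = sets (count_space UNIV)"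
      by (auto intro!: borel_open discrete_topology_class.open_discrete)
    then show "(\<lambda>(g, x). fun_act g x) \<in> borel \<Otimes>\<^sub>M borel_of ?D \<rightarrow>\<^sub>M borel_of ?D"
      using measurable_fun_act[of \<phi>\<^sub>o]
      by (simp add: measurable_cong_sets[OF sets_pair_measure_cong[OF s refl] refl])
  qed
  have skew_p: "(\<lambda>(g, x). skew g x) \<in> p \<Otimes>\<^sub>M borel_of ?X \<rightarrow>\<^sub>M borel_of ?X"
    using measurable_skew[of \<phi>\<^sub>o P]
    by (simp add: measurable_cong_sets[OF sets_pair_measure_cong[OF p(2) refl] refl])
  have fst_p: "(\<lambda>(g, x). fun_act (fst g) x) \<in> p \<Otimes>\<^sub>M borel_of ?D \<rightarrow>\<^sub>M borel_of ?D"
  proof -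
    have "fst \<in> p \<rightarrow>\<^sub>M count_space UNIV"
      unfolding measurable_cong_sets[OF trans[OF p(2) sets_borel_countable_prod] refl] by simp
    then have "(\<lambda>z. (\<lambda>(g, \<psi>). fun_act g \<psi>) (fst (fst z), snd z))
        \<in> p \<Otimes>\<^sub>M borel_of ?D \<rightarrow>\<^sub>M borel_of ?D"
      by (intro measurable_compose[OF _ measurable_fun_act] measurable_Pair) simp_all
    then show ?thesis by (simp add: case_prod_unfold)
  qed
  have bij: "bij_betw (\<lambda>\<nu>. \<nu> \<Otimes>\<^sub>M \<theta>)
      (stationary_probs (push_fst p) fun_act ?D) (stationary_probs p skew ?X)"
    unfolding push
  proof (rule bij_betwI[where g = "\<lambda>\<eta>. distr \<eta> (borel_of ?D) fst"])
    show "(\<lambda>\<nu>. \<nu> \<Otimes>\<^sub>M \<theta>) \<in> stationary_probs p (\<lambda>g. fun_act (fst g)) ?D \<rightarrow> stationary_probs p skew ?X"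
      by (intro funcsetI stationary_pair_measure p \<theta>)
    show "(\<lambda>\<eta>. distr \<eta> (borel_of ?D) fst)
        \<in> stationary_probs p skew ?X \<rightarrow> stationary_probs p (\<lambda>g. fun_act (fst g)) ?D"
    proof (intro funcsetI distr_stationary[where act = skew and f = fst, OF p(1) _ _ skew_p fst_p])
      show "fst \<in> borel_of ?X \<rightarrow>\<^sub>M borel_of ?D"
        by (intro measurable_continuous_map continuous_map_fst)
      show "fst (skew g x) = fun_act (fst g) (fst x)" for g x
        by (simp add: skew_act_def case_prod_unfold)
    qed
    show "distr (\<nu> \<Otimes>\<^sub>M \<theta>) (borel_of ?D) fst = \<nu>"
      if "\<nu> \<in> stationary_probs p (\<lambda>g. fun_act (fst g)) ?D" for \<nu>
    proof -
      have "distr (\<nu> \<Otimes>\<^sub>M \<theta>) (borel_of ?D) fst = distr (\<nu> \<Otimes>\<^sub>M \<theta>) \<nu> fst"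
        using stationary_probsD(2)[OF that] by (intro distr_cong) simp_all
      then show ?thesis by (simp add: \<theta>.distr_pair_fst)
    qed
    show "distr \<eta> (borel_of ?D) fst \<Otimes>\<^sub>M \<theta> = \<eta>" if "\<eta> \<in> stationary_probs p skew ?X" for \<eta>
      by (rule stationary_skew_product[OF p gen that ue \<theta>, symmetric])
  qed
  have hom: "homeomorphic_map ?X (hull_space (twist P \<phi>\<^sub>o)) twist_map"
    by (rule homeomorphic_map_twist_map) fact+
  have "bij_betw (\<lambda>\<eta>. distr \<eta> (borel_of (hull_space (twist P \<phi>\<^sub>o))) twist_map)
      (stationary_probs p skew ?X) (stationary_probs p set_act (hull_space (twist P \<phi>\<^sub>o)))"
  proof (rule distr_stationary_homeomorphic[where act = skew and act' = set_act, OF p(1) hom skew_p])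
    show "skew g x \<in> topspace ?X" if "x \<in> topspace ?X" for g x
      using measurable_space[OF measurable_skew, of "(g, x)"] that by (simp add: space_pair_measure)
  qed (rule twist_map_equivariant)
  from bij_betw_trans[OF bij this]
  have "bij_betw (\<lambda>\<nu>. distr (\<nu> \<Otimes>\<^sub>M \<theta>) (borel_of (hull_space (twist P \<phi>\<^sub>o))) twist_map)
      (stationary_probs (push_fst p) fun_act ?D)
      (stationary_probs p set_act (hull_space (twist P \<phi>\<^sub>o)))"
    by (simp add: comp_def)
  with bij hom show ?thesis
    unfolding c_def \<Phi> by (intro conjI ballI allI twist_map_equivariant)
qed

end
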